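(* Let $A$ be a Banach algebra, and consider the following conditions: (i) $A$ is pseudo-amenable; (ii) there is an approximate $A$-bimodule morphism $(\beta_\delta)$ from $A$ into $A\widehat{\otimes}A$ such that $\|\pi\circ\beta_\delta(a)-a\|\to 0$ for every $a\in A$; (iii) there is a $w^*$-approximate $A$-bimodule morphism $\theta_\delta:(A\widehat{\otimes}A)^*\to A^*$ $(\delta\in\Delta)$ such that $W^*OT\text{-}\lim_\delta\theta_\delta\circ\pi^*=\mathrm{id}_{A^*}$; (iv) $A$ is approximately biflat. Then (i) $\Rightarrow$ (ii) $\Rightarrow$ (iii); if $A$ has a central approximate identity, then (iii) $\Rightarrow$ (i); and if $A$ has an approximate identity, then (iv) $\Rightarrow$ (i).
   Context: $\widehat{\otimes}$ is the Banach space projective tensor product; $\pi:A\widehat{\otimes}A\to A$ is the product map $\pi(a\otimes b)=ab$. $A\widehat{\otimes}A$ is an $A$-bimodule via $a\cdot(b\otimes c)=(ab)\otimes c$, $(b\otimes c)\cdot a=b\otimes(ca)$, and duals of bimodules carry the dual actions $\langle x,a\cdot\phi\rangle=\langle x\cdot a,\phi\rangle$, $\langle x,\phi\cdot a\rangle=\langle a\cdot x,\phi\rangle$. $A$ is pseudo-amenable if there is a (not necessarily bounded) net $(m_\alpha)$ in $A\widehat{\otimes}A$ with $a\cdot m_\alpha-m_\alpha\cdot a\to 0$ and $\pi(m_\alpha)a\to a$ in norm for all $a\in A$. For Banach $A$-bimodules $X,Y$, an approximate $A$-bimodule morphism from $X$ to $Y$ is a net $(\theta_\delta)$ of bounded linear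 maps $X\to Y$ with $\|\theta_\delta(a\cdot x)-a\cdot\theta_\delta(x)\|\to0$ and $\|\theta_\delta(x\cdot a)-\theta_\delta(x)\cdot a\|\to0$ for all $a\in A$, $x\in X$. If $Y$ is a dual Banach space and norm convergence is replaced by $w^*$-convergence to $0$, it is called a $w^*$-approximate $A$-bimodule morphism. The topology $W^*OT$ on $\mathcal{B}(E,F^* )$ is determined by the seminorms $T\mapsto|\langle f,Te\rangle|$, $e\in E$, $f\in F$. $A$ is approximately biflat if there is a net $\theta_\delta:(A\widehat{\otimes}A)^*\to A^*$ of bounded $A$-bimodule morphisms with $W^*OT\text{-}\lim_\delta\theta_\delta\circ\pi^*=\mathrm{id}_{A^*}$. An approximate identity is a (possibly unbounded) two-sided approximate identity; it is central if it lies in the centre of $A$. *)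

theory Defs
  imports "HOL-Analysis.Analysis"
begin

section \<open>Complex Banach spaces and Banach algebras\<close>

class complex_vector = real_vector +
  fixes scaleC :: "complex \<Rightarrow> 'a \<Rightarrow> 'a" (infixr "*\<^sub>C" 75)
  assumes scaleC_add_right: "c *\<^sub>C (x + y) = c *\<^sub>C x + c *\<^sub>C y"
    and scaleC_add_left: "(c + d) *\<^sub>C x = c *\<^sub>C x + d *\<^sub>C x"
    and scaleC_scaleC: "c *\<^sub>C d *\<^sub>C x = (c * d) *\<^sub>C x"
    and scaleC_of_real: "of_real r *\<^sub>C x = r *\<^sub>R x"

class complex_normed_vector = complex_vector + real_normed_vector +
  assumes norm_scaleC: "norm (c *\<^sub>C x) = norm c * norm x"

class cbanach = complex_normed_vector + banach

text \<open>Neither the algebra nor its norm is assumed to have a unit.\<close>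

class complex_normed_algebra = complex_normed_vector + real_normed_algebra +
  assumes mult_scaleC_left: "(c *\<^sub>C x) * y = c *\<^sub>C (x * y)"
    and mult_scaleC_right: "x * (c *\<^sub>C y) = c *\<^sub>C (x * y)"

class complex_banach_algebra = complex_normed_algebra + banach

subclass (in complex_banach_algebra) cbanach ..

instantiation complex :: complex_banach_algebra
begin

definition scaleC_complex :: "complex \<Rightarrow> complex \<Rightarrow> complex" where
  "scaleC_complex = (*)"

instance
proof
  fix r :: real and x :: complex
  show "of_real r *\<^sub>C x = r *\<^sub>R x"
    by (simp only: scaleC_complex_def scaleR_conv_of_real)
qed (simp_all add: scaleC_complex_def algebra_simps norm_mult)

end

lemma scaleC_one [simp]: "1 *\<^sub>C x = (x :: 'a::complex_vector)"
  using scaleC_of_real[of 1 x] by simp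

lemma scaleC_zero_left [simp]: "0 *\<^sub>C x = (0 :: 'a::complex_vector)"
  using scaleC_of_real[of 0 x] by simp

lemma scaleC_minus1: "(- 1) *\<^sub>C x = - (x :: 'a::complex_vector)"
  using scaleC_of_real[of "- 1" x] by simp

lemma scaleC_zero_right [simp]: "c *\<^sub>C (0 :: 'a::complex_vector) = 0"
  using scaleC_add_right[of c 0 0] by simp

lemma scaleC_minus_right: "c *\<^sub>C (- x) = - (c *\<^sub>C (x :: 'a::complex_vector))"
  by (metis add.right_inverse add_eq_0_iff scaleC_add_right scaleC_zero_right)

lemma scaleC_diff_right: "c *\<^sub>C (x - y) = c *\<^sub>C x - c *\<^sub>C (y :: 'a::complex_vector)"
  by (metis add_uminus_conv_diff scaleC_add_right scaleC_minus_right)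

lemma scaleC_sum_list: "c *\<^sub>C sum_list xs = sum_list (map (scaleC c) xs)"
  for xs :: "'a::complex_vector list"
  by (induction xs) (simp_all add: scaleC_add_right)

lemma bounded_linear_scaleC: "bounded_linear (\<lambda>x :: 'a::complex_normed_vector. c *\<^sub>C x)"
proof (rule bounded_linear_intro[where K = "norm c"])
  show "c *\<^sub>C (r *\<^sub>R x) = r *\<^sub>R (c *\<^sub>C x)" for r and x :: 'a
    by (metis mult.commute scaleC_of_real scaleC_scaleC)
qed (simp_all add: scaleC_add_right norm_scaleC)

lemma tendsto_scaleC:
  "(f \<longlongrightarrow> l) F \<Longrightarrow> ((\<lambda>n. c *\<^sub>C f n) \<longlongrightarrow> c *\<^sub>C (l :: 'a::complex_normed_vector)) F"
  by (rule bounded_linear.tendsto[OF bounded_linear_scaleC])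

definition bounded_clinear :: "('a::complex_normed_vector \<Rightarrow> 'b::complex_normed_vector) \<Rightarrow> bool" where
  "bounded_clinear f \<longleftrightarrow> bounded_linear f \<and> (\<forall>c x. f (c *\<^sub>C x) = c *\<^sub>C f x)"

definition bounded_cbilinear ::
    "('a::complex_normed_vector \<Rightarrow> 'b::complex_normed_vector \<Rightarrow> 'c::complex_normed_vector) \<Rightarrow> bool" where
  "bounded_cbilinear B \<longleftrightarrow> bounded_bilinear B
     \<and> (\<forall>c x y. B (c *\<^sub>C x) y = c *\<^sub>C B x y) \<and> (\<forall>c x y. B x (c *\<^sub>C y) = c *\<^sub>C B x y)"

lemma bounded_clinear_compose:
  "bounded_clinear g \<Longrightarrow> bounded_clinear f \<Longrightarrow> bounded_clinear (\<lambda>x. g (f x))"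
  by (auto simp: bounded_clinear_def intro: bounded_linear_compose)

lemma bounded_cbilinear_clinear:
  assumes "bounded_cbilinear B"
  shows "bounded_clinear (B x)" and "bounded_clinear (\<lambda>x. B x y)"
  using assms by (auto simp: bounded_cbilinear_def bounded_clinear_def
      intro: bounded_bilinear.bounded_linear_left bounded_bilinear.bounded_linear_right)

section \<open>The dual space\<close>

typedef (overloaded) 'a cdual =
  "{f :: 'a::complex_normed_vector \<Rightarrow>\<^sub>L complex. \<forall>c x. blinfun_apply f (c *\<^sub>C x) = c * blinfun_apply f x}"
  by (rule exI[of _ 0]) simp

setup_lifting type_definition_cdual

lift_definition pairing :: "'a::complex_normed_vector \<Rightarrow> 'a cdual \<Rightarrow> complex" ("\<langle>_, _\<rangle>")
  is "\<lambda>x f. blinfun_apply f x" .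

instantiation cdual :: (complex_normed_vector) complex_normed_vector
begin

lift_definition zero_cdual :: "'a cdual" is 0 by simp
lift_definition plus_cdual :: "'a cdual \<Rightarrow> 'a cdual \<Rightarrow> 'a cdual" is "(+)"
  by (simp add: blinfun.add_left algebra_simps)
lift_definition minus_cdual :: "'a cdual \<Rightarrow> 'a cdual \<Rightarrow> 'a cdual" is "(-)"
  by (simp add: blinfun.diff_left algebra_simps)
lift_definition uminus_cdual :: "'a cdual \<Rightarrow> 'a cdual" is uminus
  by (simp add: blinfun.minus_left)
lift_definition scaleR_cdual :: "real \<Rightarrow> 'a cdual \<Rightarrow> 'a cdual" is "(*\<^sub>R)"
  by (simp add: blinfun.scaleR_left)
lift_definition scaleC_cdual :: "complex \<Rightarrow> 'a cdual \<Rightarrow> 'a cdual"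
  is "\<lambda>c f. blinfun_compose (blinfun_mult_right c) f"
  by simp
lift_definition norm_cdual :: "'a cdual \<Rightarrow> real" is norm .

definition dist_cdual :: "'a cdual \<Rightarrow> 'a cdual \<Rightarrow> real" where
  "dist_cdual f g = norm (f - g)"
definition sgn_cdual :: "'a cdual \<Rightarrow> 'a cdual" where
  "sgn_cdual f = inverse (norm f) *\<^sub>R f"
definition uniformity_cdual :: "('a cdual \<times> 'a cdual) filter" where
  "uniformity_cdual = (INF e\<in>{0 <..}. principal {(x, y). dist x y < e})"
definition open_cdual :: "'a cdual set \<Rightarrow> bool" where
  "open_cdual U = (\<forall>x\<in>U. \<forall>\<^sub>F (x', y) in uniformity. x' = x \<longrightarrow> y \<in> U)"

lemma norm_scaleC_cdual_le: "norm (c *\<^sub>C f) \<le> norm c * norm f" for f :: "'a cdual"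
proof (transfer, rule norm_blinfun_bound)
  fix c :: complex and f :: "'a \<Rightarrow>\<^sub>L complex" and x
  show "norm (blinfun_apply (blinfun_mult_right c o\<^sub>L f) x) \<le> norm c * norm f * norm x"
    using mult_left_mono[OF norm_blinfun[of f x], of "norm c"]
    by (simp add: norm_mult mult.assoc)
qed simp

instance
proof
  fix f g :: "'a cdual" and c d :: complex and r :: real
  show 1: "c *\<^sub>C (f + g) = c *\<^sub>C f + c *\<^sub>C g"
    by transfer (auto intro!: blinfun_eqI simp: blinfun.bilinear_simps algebra_simps)
  show "(c + d) *\<^sub>C f = c *\<^sub>C f + d *\<^sub>C f"
    by transfer (auto intro!: blinfun_eqI simp: blinfun.bilinear_simps algebra_simps)
  show 2: "c *\<^sub>C d *\<^sub>C f = (c * d) *\<^sub>C f" for c d and f :: "'a cdual"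
    by transfer (auto intro!: blinfun_eqI simp: blinfun.bilinear_simps algebra_simps)
  show "of_real r *\<^sub>C f = r *\<^sub>R f"
    by transfer (auto intro!: blinfun_eqI simp: blinfun.bilinear_simps scaleR_conv_of_real[symmetric])
  show "norm (c *\<^sub>C f) = norm c * norm f"
  proof (cases "c = 0")
    case True
    have "norm (0 *\<^sub>C f) \<le> 0" using norm_scaleC_cdual_le[of 0 f] by simp
    moreover have "0 \<le> norm (0 *\<^sub>C f)" by transfer simp
    ultimately show ?thesis using True by simp
  next
    case False
    have "1 *\<^sub>C f = f"
      by transfer (auto intro!: blinfun_eqI)
    then have "norm f = norm (inverse c *\<^sub>C c *\<^sub>C f)"
      using False by (simp add: 2)
    also have "\<dots> \<le> norm (inverse c) * norm (c *\<^sub>C f)" by (rule norm_scaleC_cdual_le)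
    finally have "norm c * norm f \<le> norm (c *\<^sub>C f)"
      using False by (simp add: norm_divide field_simps)
    with norm_scaleC_cdual_le[of c f] show ?thesis by simp
  qed
  show "norm (f + g) \<le> norm f + norm g" by transfer (rule norm_triangle_ineq)
  show "norm (r *\<^sub>R f) = \<bar>r\<bar> * norm f" by transfer simp
  show "(norm f = 0) = (f = 0)" by transfer simp
  show "dist f g = norm (f - g)" by (rule dist_cdual_def)
  show "sgn f = inverse (norm f) *\<^sub>R f" by (rule sgn_cdual_def)
  show "uniformity = (INF e\<in>{0 <..}. principal {(x :: 'a cdual, y). dist x y < e})"
    by (rule uniformity_cdual_def)
  show "open U = (\<forall>x\<in>U. \<forall>\<^sub>F (x', y) in uniformity. x' = x \<longrightarrow> y \<in> U)" for U :: "'a cdual set"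
    by (rule open_cdual_def)
  show "f + g = g + f" and "0 + f = f" and "- f + f = 0" and "f - g = f + - g"
    by (transfer, simp)+
  show "f + g + h = f + (g + h)" for h
    by transfer (simp add: add.assoc)
  show "r *\<^sub>R (f + g) = r *\<^sub>R f + r *\<^sub>R g" and "1 *\<^sub>R f = f"
    by (transfer, simp add: scaleR_add_right)+
  show "(r + s) *\<^sub>R f = r *\<^sub>R f + s *\<^sub>R f" and "r *\<^sub>R s *\<^sub>R f = (r * s) *\<^sub>R f" for s
    by (transfer, simp add: scaleR_add_left)+
qed

end

lemma pairing_norm: "norm \<langle>x, f\<rangle> \<le> norm f * norm x"
  by transfer (rule norm_blinfun)

lemma cdual_eqI: "(\<And>x. \<langle>x, f\<rangle> = \<langle>x, g\<rangle>) \<Longrightarrow> f = g"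
  by transfer (auto intro: blinfun_eqI)

lemma norm_cdual_bound: "0 \<le> b \<Longrightarrow> (\<And>x. norm \<langle>x, f\<rangle> \<le> b * norm x) \<Longrightarrow> norm f \<le> b"
  by transfer (rule norm_blinfun_bound)

lemma bounded_cbilinear_pairing: "bounded_cbilinear pairing"
  unfolding bounded_cbilinear_def
proof (intro conjI allI)
  show "bounded_bilinear (pairing :: 'a \<Rightarrow> 'a cdual \<Rightarrow> complex)"
  proof
    show "\<exists>K. \<forall>a b. norm \<langle>a :: 'a, b\<rangle> \<le> norm a * norm b * K"
      by (rule exI[of _ 1]) (metis mult.commute mult.right_neutral pairing_norm)
  qed (transfer; simp add: blinfun.bilinear_simps)+
qed (transfer; simp add: scaleC_complex_def)+

instance cdual :: (complex_normed_vector) cbanach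
proof
  fix X :: "nat \<Rightarrow> 'a cdual"
  assume X: "Cauchy X"
  have nrm: "norm (Rep_cdual f - Rep_cdual g) = norm (f - g)" for f g :: "'a cdual"
    by transfer simp
  have "Cauchy (\<lambda>n. Rep_cdual (X n))"
    using X by (auto simp: Cauchy_def dist_norm nrm)
  then obtain L where L: "(\<lambda>n. Rep_cdual (X n)) \<longlonglongrightarrow> L"
    using Cauchy_convergent convergent_def by blast
  have ev: "(\<lambda>n. blinfun_apply (Rep_cdual (X n)) x) \<longlonglongrightarrow> blinfun_apply L x" for x
    by (rule blinfun.tendsto[OF L tendsto_const])
  have "blinfun_apply L (c *\<^sub>C x) = c * blinfun_apply L x" for c x
  proof (rule LIMSEQ_unique[OF ev])
    have "blinfun_apply (Rep_cdual (X n)) (c *\<^sub>C x) = c * blinfun_apply (Rep_cdual (X n)) x" for n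
      using Rep_cdual[of "X n"] by simp
    then show "(\<lambda>n. blinfun_apply (Rep_cdual (X n)) (c *\<^sub>C x)) \<longlonglongrightarrow> c * blinfun_apply L x"
      by (simp add: tendsto_mult_left[OF ev])
  qed
  then have "L \<in> {f. \<forall>c x. blinfun_apply f (c *\<^sub>C x) = c * blinfun_apply f x}" by simp
  then obtain f where f: "L = Rep_cdual f" by (rule Rep_cdual_cases)
  have "(\<lambda>n. norm (X n - f)) \<longlonglongrightarrow> 0"
    using tendsto_norm_zero[OF LIM_zero[OF L]] by (simp add: f nrm)
  then have "X \<longlonglongrightarrow> f"
    by (rule LIM_zero_cancel[OF tendsto_norm_zero_cancel])
  then show "convergent X" by (auto simp: convergent_def)
qed

definition dual_map :: "('a::complex_normed_vector \<Rightarrow> 'b::complex_normed_vector) \<Rightarrow> 'b cdual \<Rightarrow> 'a cdual" where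
  "dual_map T \<phi> = (THE \<psi>. \<forall>x. \<langle>x, \<psi>\<rangle> = \<langle>T x, \<phi>\<rangle>)"

lemma pairing_dual_map:
  assumes "bounded_clinear T"
  shows "\<langle>x, dual_map T \<phi>\<rangle> = \<langle>T x, \<phi>\<rangle>"
proof -
  have cl: "bounded_clinear (\<lambda>x. \<langle>T x, \<phi>\<rangle>)"
    using bounded_clinear_compose[OF bounded_cbilinear_clinear(2)[OF bounded_cbilinear_pairing] assms] .
  define \<psi> where "\<psi> = Abs_cdual (Blinfun (\<lambda>x. \<langle>T x, \<phi>\<rangle>))"
  have "\<forall>x. \<langle>x, \<psi>\<rangle> = \<langle>T x, \<phi>\<rangle>"
    using cl unfolding \<psi>_def pairing.rep_eq
    by (subst Abs_cdual_inverse)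
      (auto simp: bounded_linear_Blinfun_apply bounded_clinear_def scaleC_complex_def)
  then have "\<exists>!\<psi>. \<forall>x. \<langle>x, \<psi>\<rangle> = \<langle>T x, \<phi>\<rangle>"
    by (metis cdual_eqI)
  from theI'[OF this] show ?thesis unfolding dual_map_def by blast
qed

section \<open>The algebraic tensor product\<close>

text \<open>The list \<open>[(a\<^sub>1, b\<^sub>1), \<dots>, (a\<^sub>n, b\<^sub>n)]\<close> stands for the formal sum
  \<open>a\<^sub>1 \<otimes> b\<^sub>1 + \<dots> + a\<^sub>n \<otimes> b\<^sub>n\<close>; scalars are absorbed into the first factor. The relation below is
  the congruence generated by commutativity of addition and bilinearity of \<open>\<otimes>\<close>.\<close>

inductive tensor_eq :: "('a::complex_vector \<times> 'b::complex_vector) list \<Rightarrow> ('a \<times> 'b) list \<Rightarrow> bool" where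
  refl: "tensor_eq xs xs"
| sym: "tensor_eq xs ys \<Longrightarrow> tensor_eq ys xs"
| trans: "tensor_eq xs ys \<Longrightarrow> tensor_eq ys zs \<Longrightarrow> tensor_eq xs zs"
| append: "tensor_eq xs xs' \<Longrightarrow> tensor_eq ys ys' \<Longrightarrow> tensor_eq (xs @ ys) (xs' @ ys')"
| commute: "tensor_eq (xs @ ys) (ys @ xs)"
| add_left: "tensor_eq [(a + a', b)] [(a, b), (a', b)]"
| add_right: "tensor_eq [(a, b + b')] [(a, b), (a, b')]"
| scale: "tensor_eq [(c *\<^sub>C a, b)] [(a, c *\<^sub>C b)]"
| zero: "tensor_eq [(0, b)] []"

quotient_type (overloaded) ('a, 'b) atensor =
  "('a::complex_vector \<times> 'b::complex_vector) list" / tensor_eq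
  by (rule equivpI) (blast intro: reflpI sympI transpI tensor_eq.intros)+

lift_definition atens :: "'a::complex_vector \<Rightarrow> 'b::complex_vector \<Rightarrow> ('a, 'b) atensor"
  is "\<lambda>a b. [(a, b)]" .

instantiation atensor :: (complex_vector, complex_vector) comm_monoid_add
begin

lift_definition zero_atensor :: "('a, 'b) atensor" is "[]" .
lift_definition plus_atensor :: "('a, 'b) atensor \<Rightarrow> ('a, 'b) atensor \<Rightarrow> ('a, 'b) atensor" is "(@)"
  by (rule tensor_eq.append)

instance
  by standard (transfer; simp add: tensor_eq.refl tensor_eq.commute)+

end

lemma abs_atensor_eq_sum: "abs_atensor xs = (\<Sum>(a, b)\<leftarrow>xs. atens a b)"
proof (induction xs)
  case Nil
  show ?case by (simp add: zero_atensor_def)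
next
  case (Cons x xs)
  obtain a b where x: "x = (a, b)" by (cases x)
  have "abs_atensor ((a, b) # xs) = atens a b + abs_atensor xs"
    by (simp add: atens.abs_eq plus_atensor.abs_eq)
  with Cons show ?case by (simp add: x)
qed

lemma atensor_exhaust:
  obtains xs where "u = (\<Sum>(a, b)\<leftarrow>xs. atens a b)"
  by (metis abs_atensor_eq_sum Quotient3_abs_rep[OF Quotient3_atensor])

lemma atensor_induct [case_names zero add]:
  assumes "P 0" and "\<And>a b u. P u \<Longrightarrow> P (atens a b + u)"
  shows "P u"
proof -
  obtain xs where u: "u = (\<Sum>(a, b)\<leftarrow>xs. atens a b)" by (rule atensor_exhaust)
  show ?thesis unfolding u by (induction xs) (auto intro: assms)
qed

instantiation atensor :: (complex_vector, complex_vector) complex_vector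
begin

lift_definition scaleC_atensor :: "complex \<Rightarrow> ('a, 'b) atensor \<Rightarrow> ('a, 'b) atensor"
  is "\<lambda>c. map (\<lambda>(a, b). (c *\<^sub>C a, b))"
proof -
  fix c :: complex and xs ys :: "('a \<times> 'b) list"
  assume "tensor_eq xs ys"
  then show "tensor_eq (map (\<lambda>(a, b). (c *\<^sub>C a, b)) xs) (map (\<lambda>(a, b). (c *\<^sub>C a, b)) ys)"
  proof induction
    case (scale d a b)
    then show ?case
      using tensor_eq.scale[of d "c *\<^sub>C a" b] by (simp add: scaleC_scaleC mult.commute)
  qed (auto intro: tensor_eq.intros simp: scaleC_add_right)
qed

definition scaleR_atensor :: "real \<Rightarrow> ('a, 'b) atensor \<Rightarrow> ('a, 'b) atensor" where
  "scaleR_atensor r u = of_real r *\<^sub>C u"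
definition uminus_atensor :: "('a, 'b) atensor \<Rightarrow> ('a, 'b) atensor" where
  "uminus_atensor u = (- 1) *\<^sub>C u"
definition minus_atensor :: "('a, 'b) atensor \<Rightarrow> ('a, 'b) atensor \<Rightarrow> ('a, 'b) atensor" where
  "minus_atensor u v = u + - v"

lemma atens_add_left': "atens (a + a') b = atens a b + atens a' (b :: 'b)" for a a' :: 'a
  by transfer (simp add: tensor_eq.add_left)

lemma scaleC_atens': "c *\<^sub>C atens a b = atens (c *\<^sub>C a) (b :: 'b)" for a :: 'a
  by transfer (simp add: tensor_eq.refl)

lemma scaleC_atensor_add: "c *\<^sub>C (u + v) = c *\<^sub>C u + c *\<^sub>C v" for u v :: "('a, 'b) atensor"
  by transfer (simp add: tensor_eq.refl)

lemma scaleC_atensor_zero: "c *\<^sub>C (0 :: ('a, 'b) atensor) = 0"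
  by transfer (simp add: tensor_eq.refl)

lemma scaleC_atensor_add_left: "(c + d) *\<^sub>C u = c *\<^sub>C u + d *\<^sub>C u" for u :: "('a, 'b) atensor"
  by (induction u rule: atensor_induct)
    (simp_all add: scaleC_atensor_zero scaleC_atensor_add scaleC_atens' scaleC_add_left
      atens_add_left' algebra_simps)

lemma scaleC_atensor_scaleC: "c *\<^sub>C d *\<^sub>C u = (c * d) *\<^sub>C u" for u :: "('a, 'b) atensor"
  by (induction u rule: atensor_induct)
    (simp_all add: scaleC_atensor_zero scaleC_atensor_add scaleC_atens' scaleC_scaleC)

lemma scaleC_atensor_one: "1 *\<^sub>C u = u" for u :: "('a, 'b) atensor"
  by (induction u rule: atensor_induct)
    (simp_all add: scaleC_atensor_zero scaleC_atensor_add scaleC_atens')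

lemma atens_zero_left': "atens (0 :: 'a) (b :: 'b) = 0"
  by transfer (rule tensor_eq.zero)

lemma scaleC_atensor_zero_left: "0 *\<^sub>C u = 0" for u :: "('a, 'b) atensor"
  by (induction u rule: atensor_induct)
    (simp_all add: scaleC_atensor_zero scaleC_atensor_add scaleC_atens' atens_zero_left')

instance
proof
  fix u v :: "('a, 'b) atensor" and c d :: complex and r s :: real
  have "- u + u = (- 1 + 1) *\<^sub>C u"
    by (simp only: scaleC_atensor_add_left uminus_atensor_def scaleC_atensor_one)
  then show "- u + u = 0" by (simp add: scaleC_atensor_zero_left)
qed (simp_all add: minus_atensor_def scaleR_atensor_def scaleC_atensor_add
    scaleC_atensor_add_left scaleC_atensor_scaleC scaleC_atensor_one)

end

lemma atens_add_left: "atens (a + a') b = atens a b + atens a' b"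
  by (rule atens_add_left')

lemma atens_add_right: "atens a (b + b') = atens a b + atens a b'"
  by transfer (simp add: tensor_eq.add_right)

lemma atens_scaleC_left: "atens (c *\<^sub>C a) b = c *\<^sub>C atens a b"
  by (rule scaleC_atens'[symmetric])

lemma atens_scaleC_right: "atens a (c *\<^sub>C b) = c *\<^sub>C atens a b"
  by transfer (simp add: tensor_eq.scale tensor_eq.sym)

definition alift :: "('a::complex_vector \<Rightarrow> 'b::complex_vector \<Rightarrow> 'c::complex_vector) \<Rightarrow> ('a, 'b) atensor \<Rightarrow> 'c" where
  "alift B u = (\<Sum>(a, b)\<leftarrow>rep_atensor u. B a b)"

lemma alift_sum:
  assumes "\<And>a a' b. B (a + a') b = B a b + B a' b" and "\<And>a b b'. B a (b + b') = B a b + B a b'"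
    and "\<And>c a b. B (c *\<^sub>C a) b = c *\<^sub>C B a b" and "\<And>c a b. B a (c *\<^sub>C b) = c *\<^sub>C B a b"
  shows "alift B (\<Sum>(a, b)\<leftarrow>xs. atens a b) = (\<Sum>(a, b)\<leftarrow>xs. B a b)"
proof -
  have *: "tensor_eq xs ys \<Longrightarrow> (\<Sum>(a, b)\<leftarrow>xs. B a b) = (\<Sum>(a, b)\<leftarrow>ys. B a b)" for xs ys
  proof (induction rule: tensor_eq.induct)
    case (zero b)
    then show ?case using assms(3)[of 0 0 b] by simp
  qed (simp_all add: assms add.commute)
  have "abs_atensor (rep_atensor (abs_atensor xs)) = abs_atensor xs"
    by (rule Quotient3_abs_rep[OF Quotient3_atensor])
  then have "tensor_eq (rep_atensor (abs_atensor xs)) xs"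
    by (simp add: atensor.abs_eq_iff)
  from *[OF this] show ?thesis by (simp add: alift_def flip: abs_atensor_eq_sum)
qed

section \<open>The projective norm\<close>

definition proj_norm :: "('a::complex_normed_vector, 'b::complex_normed_vector) atensor \<Rightarrow> real" where
  "proj_norm u = Inf {(\<Sum>(a, b)\<leftarrow>xs. norm a * norm b) | xs. u = (\<Sum>(a, b)\<leftarrow>xs. atens a b)}"

lemma sum_list_norm_nonneg: "0 \<le> (\<Sum>(a, b)\<leftarrow>xs. norm a * norm b)"
  by (rule sum_list_nonneg) auto

lemma proj_norm_le: "proj_norm (\<Sum>(a, b)\<leftarrow>xs. atens a b) \<le> (\<Sum>(a, b)\<leftarrow>xs. norm a * norm b)"
  unfolding proj_norm_def
  by (rule cInf_lower) (auto intro!: bdd_belowI[of _ 0] sum_list_norm_nonneg)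

lemma proj_norm_approx:
  assumes "0 < e"
  obtains xs where "u = (\<Sum>(a, b)\<leftarrow>xs. atens a b)"
    and "(\<Sum>(a, b)\<leftarrow>xs. norm a * norm b) < proj_norm u + e"
proof -
  let ?S = "{(\<Sum>(a, b)\<leftarrow>xs. norm a * norm b) | xs. u = (\<Sum>(a, b)\<leftarrow>xs. atens a b)}"
  have "?S \<noteq> {}" using atensor_exhaust[of u] by blast
  moreover have "Inf ?S < proj_norm u + e" using assms by (simp add: proj_norm_def)
  ultimately obtain y where "y \<in> ?S" "y < proj_norm u + e" by (rule cInf_lessD[elim_format]) blast
  then show ?thesis using that by blast
qed

lemma proj_norm_nonneg: "0 \<le> proj_norm u"
proof (rule field_le_epsilon)
  fix e :: real
  assume "0 < e"
  then obtain xs where "u = (\<Sum>(a, b)\<leftarrow>xs. atens a b)"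
    and "(\<Sum>(a, b)\<leftarrow>xs. norm a * norm b) < proj_norm u + e"
    by (rule proj_norm_approx)
  then show "0 \<le> proj_norm u + e"
    using sum_list_norm_nonneg[of xs] by simp
qed

lemma proj_norm_zero [simp]: "proj_norm (0 :: ('a::complex_normed_vector, 'b::complex_normed_vector) atensor) = 0"
  using proj_norm_le[of "[] :: ('a \<times> 'b) list"] proj_norm_nonneg[of "0 :: ('a, 'b) atensor"] by simp

lemma proj_norm_atens: "proj_norm (atens a b) \<le> norm a * norm b"
  using proj_norm_le[of "[(a, b)]"] by simp

lemma proj_norm_triangle: "proj_norm (u + v) \<le> proj_norm u + proj_norm v"
proof (rule field_le_epsilon)
  fix e :: real
  assume "0 < e"
  then have e: "0 < e / 2" by simp
  obtain xs where xs: "u = (\<Sum>(a, b)\<leftarrow>xs. atens a b)"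
    "(\<Sum>(a, b)\<leftarrow>xs. norm a * norm b) < proj_norm u + e / 2"
    by (rule proj_norm_approx[OF e])
  obtain ys where ys: "v = (\<Sum>(a, b)\<leftarrow>ys. atens a b)"
    "(\<Sum>(a, b)\<leftarrow>ys. norm a * norm b) < proj_norm v + e / 2"
    by (rule proj_norm_approx[OF e])
  have "proj_norm (u + v) \<le> (\<Sum>(a, b)\<leftarrow>xs @ ys. norm a * norm b)"
    using proj_norm_le[of "xs @ ys"] by (simp add: xs(1) ys(1))
  then show "proj_norm (u + v) \<le> proj_norm u + proj_norm v + e"
    using xs(2) ys(2) by simp
qed

lemma proj_norm_scaleC_le: "proj_norm (c *\<^sub>C u) \<le> norm c * proj_norm u"
proof (rule field_le_epsilon)
  fix e :: real
  assume "0 < e"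
  then have e: "0 < e / (norm c + 1)"
    by (intro divide_pos_pos) (auto intro: add_nonneg_pos)
  obtain xs where xs: "u = (\<Sum>(a, b)\<leftarrow>xs. atens a b)"
    "(\<Sum>(a, b)\<leftarrow>xs. norm a * norm b) < proj_norm u + e / (norm c + 1)"
    by (rule proj_norm_approx[OF e])
  have "c *\<^sub>C u = (\<Sum>(a, b)\<leftarrow>map (\<lambda>(a, b). (c *\<^sub>C a, b)) xs. atens a b)"
    by (simp add: xs(1) scaleC_sum_list atens_scaleC_left case_prod_unfold comp_def)
  then have "proj_norm (c *\<^sub>C u) \<le> (\<Sum>(a, b)\<leftarrow>map (\<lambda>(a, b). (c *\<^sub>C a, b)) xs. norm a * norm b)"
    using proj_norm_le by metis
  also have "\<dots> = norm c * (\<Sum>(a, b)\<leftarrow>xs. norm a * norm b)"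
    by (simp add: norm_scaleC case_prod_unfold comp_def mult.assoc flip: sum_list_const_mult)
  also have "\<dots> \<le> norm c * (proj_norm u + e / (norm c + 1))"
    using xs(2) by (intro mult_left_mono) auto
  also have "\<dots> = norm c * proj_norm u + e * (norm c / (norm c + 1))"
    by (simp add: algebra_simps)
  also have "e * (norm c / (norm c + 1)) \<le> e * 1"
    using \<open>0 < e\<close> by (intro mult_left_mono) (auto simp: divide_le_eq add_nonneg_pos)
  finally show "proj_norm (c *\<^sub>C u) \<le> norm c * proj_norm u + e" by simp
qed

lemma proj_norm_scaleC: "proj_norm (c *\<^sub>C u) = norm c * proj_norm u"
proof (cases "c = 0")
  case False
  have "proj_norm u = proj_norm (inverse c *\<^sub>C c *\<^sub>C u)"
    using False by (simp add: scaleC_scaleC)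
  also have "\<dots> \<le> norm (inverse c) * proj_norm (c *\<^sub>C u)" by (rule proj_norm_scaleC_le)
  finally have "norm c * proj_norm u \<le> proj_norm (c *\<^sub>C u)"
    using False by (simp add: norm_divide field_simps)
  with proj_norm_scaleC_le[of c u] show ?thesis by simp
qed simp

lemma proj_norm_minus: "proj_norm (- u) = proj_norm u"
  using proj_norm_scaleC[of "- 1" u] by (simp add: scaleC_minus1)

lemma proj_norm_minus_commute: "proj_norm (u - v) = proj_norm (v - u)"
  using proj_norm_minus[of "u - v"] by simp

lemma proj_norm_triangle_diff: "\<bar>proj_norm u - proj_norm v\<bar> \<le> proj_norm (u - v)"
  using proj_norm_triangle[of "u - v" v] proj_norm_triangle[of "v - u" u]
    proj_norm_minus_commute[of u v] by simp

lemma alift_bound: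
  assumes B: "bounded_cbilinear B"
  shows "\<exists>K\<ge>0. \<forall>u. norm (alift B u) \<le> K * proj_norm u"
proof -
  interpret bounded_bilinear B using B by (simp add: bounded_cbilinear_def)
  have *: "alift B (\<Sum>(a, b)\<leftarrow>xs. atens a b) = (\<Sum>(a, b)\<leftarrow>xs. B a b)" for xs
    by (rule alift_sum) (use B in \<open>auto simp: bounded_cbilinear_def add_left add_right\<close>)
  obtain K where K: "0 < K" "\<And>a b. norm (B a b) \<le> norm a * norm b * K"
    using pos_bounded by blast
  have "norm (alift B u) \<le> K * proj_norm u" for u
  proof (rule field_le_epsilon)
    fix e :: real
    assume "0 < e"
    with K(1) have "0 < e / K" by simp
    then obtain xs where xs: "u = (\<Sum>(a, b)\<leftarrow>xs. atens a b)"
      "(\<Sum>(a, b)\<leftarrow>xs. norm a * norm b) < proj_norm u + e / K"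
      by (rule proj_norm_approx)
    have "norm (alift B u) \<le> K * (\<Sum>(a, b)\<leftarrow>xs. norm a * norm b)"
      unfolding xs(1) *
    proof (induction xs)
      case (Cons x xs)
      obtain a b where x: "x = (a, b)" by (cases x)
      have "norm (\<Sum>(a, b)\<leftarrow>x # xs. B a b) \<le> norm (B a b) + norm (\<Sum>(a, b)\<leftarrow>xs. B a b)"
        by (simp add: x norm_triangle_ineq)
      with Cons K(2)[of a b] show ?case by (simp add: x algebra_simps)
    qed simp
    also have "\<dots> \<le> K * (proj_norm u + e / K)"
      using xs(2) K(1) by (intro mult_left_mono) auto
    finally show "norm (alift B u) \<le> K * proj_norm u + e"
      using K(1) by (simp add: algebra_simps)
  qed
  with K(1) show ?thesis by (intro exI[of _ K]) auto
qed

lemma alift_add: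
  assumes "bounded_cbilinear B"
  shows "alift B (u + v) = alift B u + alift B v"
    and "alift B (c *\<^sub>C u) = c *\<^sub>C alift B u"
    and "alift B (atens a b) = B a b"
proof -
  interpret bounded_bilinear B using assms by (simp add: bounded_cbilinear_def)
  have *: "alift B (\<Sum>(a, b)\<leftarrow>xs. atens a b) = (\<Sum>(a, b)\<leftarrow>xs. B a b)" for xs
    by (rule alift_sum) (use assms in \<open>auto simp: bounded_cbilinear_def add_left add_right\<close>)
  obtain xs where xs: "u = (\<Sum>(a, b)\<leftarrow>xs. atens a b)" by (rule atensor_exhaust)
  obtain ys where ys: "v = (\<Sum>(a, b)\<leftarrow>ys. atens a b)" by (rule atensor_exhaust)
  show "alift B (u + v) = alift B u + alift B v"
    using *[of "xs @ ys"] *[of xs] *[of ys] by (simp add: xs ys)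
  have "c *\<^sub>C u = (\<Sum>(a, b)\<leftarrow>map (\<lambda>(a, b). (c *\<^sub>C a, b)) xs. atens a b)"
    by (simp add: xs scaleC_sum_list atens_scaleC_left case_prod_unfold comp_def)
  then have "alift B (c *\<^sub>C u) = (\<Sum>(a, b)\<leftarrow>map (\<lambda>(a, b). (c *\<^sub>C a, b)) xs. B a b)"
    using * by metis
  also have "\<dots> = c *\<^sub>C (\<Sum>(a, b)\<leftarrow>xs. B a b)"
    using assms by (simp add: scaleC_sum_list case_prod_unfold comp_def bounded_cbilinear_def)
  also have "\<dots> = c *\<^sub>C alift B u"
    by (simp only: xs *)
  finally show "alift B (c *\<^sub>C u) = c *\<^sub>C alift B u" .
  show "alift B (atens a b) = B a b" using *[of "[(a, b)]"] by simp
qed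


section \<open>The projective tensor product\<close>

text \<open>The completion of the algebraic tensor product in the projective norm, as Cauchy sequences
  modulo null sequences. The construction only uses that \<^const>\<open>proj_norm\<close> is a seminorm.\<close>

definition proj_Cauchy :: "(nat \<Rightarrow> ('a::complex_normed_vector, 'b::complex_normed_vector) atensor) \<Rightarrow> bool" where
  "proj_Cauchy X \<longleftrightarrow> (\<forall>e>0. \<exists>N. \<forall>m\<ge>N. \<forall>n\<ge>N. proj_norm (X m - X n) < e)"

definition ptensor_rel ::
    "(nat \<Rightarrow> ('a::complex_normed_vector, 'b::complex_normed_vector) atensor) \<Rightarrow> (nat \<Rightarrow> ('a, 'b) atensor) \<Rightarrow> bool" where
  "ptensor_rel X Y \<longleftrightarrow> proj_Cauchy X \<and> proj_Cauchy Y \<and> (\<lambda>n. proj_norm (X n - Y n)) \<longlonglongrightarrow> 0"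

lemma proj_Cauchy_const: "proj_Cauchy (\<lambda>_. u)"
  by (simp add: proj_Cauchy_def)

lemma proj_null_add:
  assumes "(\<lambda>n. proj_norm (X n)) \<longlonglongrightarrow> 0" and "(\<lambda>n. proj_norm (Y n)) \<longlonglongrightarrow> 0"
  shows "(\<lambda>n. proj_norm (X n + Y n)) \<longlonglongrightarrow> 0"
  by (rule tendsto_sandwich[OF _ _ tendsto_const tendsto_add_zero[OF assms]])
    (auto simp: proj_norm_nonneg intro!: always_eventually proj_norm_triangle)

lemma ptensor_rel_refl: "ptensor_rel X X \<longleftrightarrow> proj_Cauchy X"
  by (simp add: ptensor_rel_def)

quotient_type (overloaded) ('a, 'b) ptensor =
  "nat \<Rightarrow> ('a::complex_normed_vector, 'b::complex_normed_vector) atensor" / partial: ptensor_rel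
proof (rule part_equivpI)
  show "\<exists>X :: nat \<Rightarrow> ('a, 'b) atensor. ptensor_rel X X"
    using proj_Cauchy_const by (auto simp: ptensor_rel_refl)
  show "symp (ptensor_rel :: (nat \<Rightarrow> ('a, 'b) atensor) \<Rightarrow> _)"
    by (rule sympI) (auto simp: ptensor_rel_def proj_norm_minus_commute)
  show "transp (ptensor_rel :: (nat \<Rightarrow> ('a, 'b) atensor) \<Rightarrow> _)"
  proof (rule transpI)
    fix X Y Z :: "nat \<Rightarrow> ('a, 'b) atensor"
    assume "ptensor_rel X Y" and "ptensor_rel Y Z"
    then show "ptensor_rel X Z"
      using proj_null_add[of "\<lambda>n. X n - Y n" "\<lambda>n. Y n - Z n"] by (auto simp: ptensor_rel_def)
  qed
qed

lemma proj_Cauchy_add: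
  assumes "proj_Cauchy X" and "proj_Cauchy Y"
  shows "proj_Cauchy (\<lambda>n. X n + Y n)"
  unfolding proj_Cauchy_def
proof (intro allI impI)
  fix e :: real
  assume "0 < e"
  then have "0 < e / 2" by simp
  then obtain M N where M: "\<And>m n. m \<ge> M \<Longrightarrow> n \<ge> M \<Longrightarrow> proj_norm (X m - X n) < e / 2"
    and N: "\<And>m n. m \<ge> N \<Longrightarrow> n \<ge> N \<Longrightarrow> proj_norm (Y m - Y n) < e / 2"
    using assms unfolding proj_Cauchy_def by meson
  show "\<exists>N. \<forall>m\<ge>N. \<forall>n\<ge>N. proj_norm (X m + Y m - (X n + Y n)) < e"
  proof (intro exI[of _ "max M N"] allI impI)
    fix m n
    assume "max M N \<le> m" and "max M N \<le> n"
    moreover have "proj_norm (X m + Y m - (X n + Y n)) \<le> proj_norm (X m - X n) + proj_norm (Y m - Y n)"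
      using proj_norm_triangle[of "X m - X n" "Y m - Y n"] by (simp add: algebra_simps)
    ultimately show "proj_norm (X m + Y m - (X n + Y n)) < e"
      using M[of m n] N[of m n] by simp
  qed
qed

lemma proj_Cauchy_scaleC:
  assumes "proj_Cauchy X"
  shows "proj_Cauchy (\<lambda>n. c *\<^sub>C X n)"
  unfolding proj_Cauchy_def
proof (intro allI impI)
  fix e :: real
  assume "0 < e"
  then have "0 < e / (norm c + 1)"
    by (intro divide_pos_pos) (auto intro: add_nonneg_pos)
  then obtain N where N: "\<And>m n. m \<ge> N \<Longrightarrow> n \<ge> N \<Longrightarrow> proj_norm (X m - X n) < e / (norm c + 1)"
    using assms unfolding proj_Cauchy_def by meson
  show "\<exists>N. \<forall>m\<ge>N. \<forall>n\<ge>N. proj_norm (c *\<^sub>C X m - c *\<^sub>C X n) < e"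
  proof (intro exI[of _ N] allI impI)
    fix m n
    assume "N \<le> m" and "N \<le> n"
    have "proj_norm (c *\<^sub>C X m - c *\<^sub>C X n) = norm c * proj_norm (X m - X n)"
      by (simp add: proj_norm_scaleC flip: scaleC_diff_right)
    also have "\<dots> \<le> (norm c + 1) * proj_norm (X m - X n)"
      by (simp add: mult_right_mono proj_norm_nonneg)
    also have "\<dots> < (norm c + 1) * (e / (norm c + 1))"
      using N[OF \<open>N \<le> m\<close> \<open>N \<le> n\<close>] by (intro mult_strict_left_mono) (auto intro: add_nonneg_pos)
    also have "\<dots> = e"
      using add_nonneg_pos[OF norm_ge_zero[of c] zero_less_one] by simp
    finally show "proj_norm (c *\<^sub>C X m - c *\<^sub>C X n) < e" .
  qed
qed

lemma ptensor_rel_add: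
  "ptensor_rel X X' \<Longrightarrow> ptensor_rel Y Y' \<Longrightarrow> ptensor_rel (\<lambda>n. X n + Y n) (\<lambda>n. X' n + Y' n)"
  using proj_null_add[of "\<lambda>n. X n - X' n" "\<lambda>n. Y n - Y' n"]
  by (simp add: ptensor_rel_def proj_Cauchy_add algebra_simps)

lemma ptensor_rel_scaleC:
  "ptensor_rel X Y \<Longrightarrow> ptensor_rel (\<lambda>n. c *\<^sub>C X n) (\<lambda>n. c *\<^sub>C Y n)"
  by (auto simp: ptensor_rel_def proj_Cauchy_scaleC proj_norm_scaleC tendsto_mult_right_zero
      simp flip: scaleC_diff_right)

lemma ptensor_rel_minus: "ptensor_rel X Y \<Longrightarrow> ptensor_rel (\<lambda>n. - X n) (\<lambda>n. - Y n)"
  using ptensor_rel_scaleC[of X Y "- 1"] by (simp add: scaleC_minus1)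

lemma proj_norm_convergent:
  assumes "proj_Cauchy X"
  shows "(\<lambda>n. proj_norm (X n)) \<longlonglongrightarrow> lim (\<lambda>n. proj_norm (X n))"
proof -
  have "Cauchy (\<lambda>n. proj_norm (X n))"
    unfolding Cauchy_def dist_real_def
    using assms le_less_trans[OF proj_norm_triangle_diff] by (fastforce simp: proj_Cauchy_def)
  then show ?thesis by (simp add: Cauchy_convergent_iff convergent_LIMSEQ_iff)
qed

instantiation ptensor :: (complex_normed_vector, complex_normed_vector) complex_normed_vector
begin

lift_definition zero_ptensor :: "('a, 'b) ptensor" is "\<lambda>_. 0"
  by (simp add: ptensor_rel_refl proj_Cauchy_const)
lift_definition plus_ptensor :: "('a, 'b) ptensor \<Rightarrow> ('a, 'b) ptensor \<Rightarrow> ('a, 'b) ptensor"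
  is "\<lambda>X Y n. X n + Y n"
  by (rule ptensor_rel_add)
lift_definition uminus_ptensor :: "('a, 'b) ptensor \<Rightarrow> ('a, 'b) ptensor" is "\<lambda>X n. - X n"
  by (rule ptensor_rel_minus)
lift_definition minus_ptensor :: "('a, 'b) ptensor \<Rightarrow> ('a, 'b) ptensor \<Rightarrow> ('a, 'b) ptensor"
  is "\<lambda>X Y n. X n - Y n"
  unfolding diff_conv_add_uminus by (intro ptensor_rel_add ptensor_rel_minus)
lift_definition scaleC_ptensor :: "complex \<Rightarrow> ('a, 'b) ptensor \<Rightarrow> ('a, 'b) ptensor"
  is "\<lambda>c X n. c *\<^sub>C X n"
  by (rule ptensor_rel_scaleC)
lift_definition scaleR_ptensor :: "real \<Rightarrow> ('a, 'b) ptensor \<Rightarrow> ('a, 'b) ptensor"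
  is "\<lambda>r X n. r *\<^sub>R X n"
  unfolding scaleC_of_real[symmetric] by (rule ptensor_rel_scaleC)
lift_definition norm_ptensor :: "('a, 'b) ptensor \<Rightarrow> real" is "\<lambda>X. lim (\<lambda>n. proj_norm (X n))"
proof -
  fix X Y :: "nat \<Rightarrow> ('a, 'b) atensor"
  assume XY: "ptensor_rel X Y"
  have "(\<lambda>n. proj_norm (X n) - proj_norm (Y n)) \<longlonglongrightarrow> 0"
    by (rule Lim_null_comparison[where g = "\<lambda>n. proj_norm (X n - Y n)"])
      (use XY in \<open>auto simp: ptensor_rel_def intro!: always_eventually proj_norm_triangle_diff\<close>)
  moreover have "(\<lambda>n. proj_norm (X n) - proj_norm (Y n)) \<longlonglongrightarrow>
      lim (\<lambda>n. proj_norm (X n)) - lim (\<lambda>n. proj_norm (Y n))"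
    by (intro tendsto_diff proj_norm_convergent) (use XY in \<open>auto simp: ptensor_rel_def\<close>)
  ultimately show "lim (\<lambda>n. proj_norm (X n)) = lim (\<lambda>n. proj_norm (Y n))"
    using LIMSEQ_unique by fastforce
qed

definition dist_ptensor :: "('a, 'b) ptensor \<Rightarrow> ('a, 'b) ptensor \<Rightarrow> real" where
  "dist_ptensor s t = norm (s - t)"
definition sgn_ptensor :: "('a, 'b) ptensor \<Rightarrow> ('a, 'b) ptensor" where
  "sgn_ptensor t = inverse (norm t) *\<^sub>R t"
definition uniformity_ptensor :: "(('a, 'b) ptensor \<times> ('a, 'b) ptensor) filter" where
  "uniformity_ptensor = (INF e\<in>{0 <..}. principal {(x, y). dist x y < e})"
definition open_ptensor :: "('a, 'b) ptensor set \<Rightarrow> bool" where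
  "open_ptensor U = (\<forall>x\<in>U. \<forall>\<^sub>F (x', y) in uniformity. x' = x \<longrightarrow> y \<in> U)"

instance
proof
  fix f g h :: "('a, 'b) ptensor" and c d :: complex and r s :: real
  have rel_refl: "ptensor_rel X Y" if "ptensor_rel X X" "X = Y" for X Y :: "nat \<Rightarrow> ('a, 'b) atensor"
    using that by simp
  show "f + g = g + f"
    by transfer (rule rel_refl; simp add: ptensor_rel_add add.commute)
  show "f + g + h = f + (g + h)"
    by transfer (rule rel_refl; simp add: ptensor_rel_add add.assoc)
  show "0 + f = f"
    by transfer simp
  show "- f + f = 0"
    by transfer (simp add: ptensor_rel_refl proj_Cauchy_const)
  show "f - g = f + - g"
    by transfer (rule rel_refl; simp only: diff_conv_add_uminus ptensor_rel_add ptensor_rel_minus)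
  show "c *\<^sub>C (f + g) = c *\<^sub>C f + c *\<^sub>C g"
    by transfer (rule rel_refl; simp add: scaleC_add_right ptensor_rel_scaleC ptensor_rel_add)
  show "(c + d) *\<^sub>C f = c *\<^sub>C f + d *\<^sub>C f"
    by transfer (rule rel_refl; simp add: scaleC_add_left ptensor_rel_scaleC ptensor_rel_add)
  show "c *\<^sub>C d *\<^sub>C f = (c * d) *\<^sub>C f"
    by transfer (rule rel_refl; simp add: scaleC_scaleC ptensor_rel_scaleC)
  show scaleR: "of_real r *\<^sub>C f = r *\<^sub>R f" for r and f :: "('a, 'b) ptensor"
    by transfer (rule rel_refl, rule ptensor_rel_scaleC, assumption, simp add: scaleC_of_real)
  show "r *\<^sub>R (f + g) = r *\<^sub>R f + r *\<^sub>R g"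
    by transfer (rule rel_refl; simp add: scaleC_add_right ptensor_rel_scaleC ptensor_rel_add flip: scaleC_of_real)
  show "(r + s) *\<^sub>R f = r *\<^sub>R f + s *\<^sub>R f"
    by transfer (rule rel_refl; simp add: scaleC_add_left ptensor_rel_scaleC ptensor_rel_add flip: scaleC_of_real)
  show "r *\<^sub>R s *\<^sub>R f = (r * s) *\<^sub>R f"
    by transfer (rule rel_refl; simp add: scaleC_scaleC ptensor_rel_scaleC flip: scaleC_of_real)
  show "1 *\<^sub>R f = f"
    by transfer simp
  show norm_scaleC: "norm (c *\<^sub>C f) = norm c * norm f" for c :: complex and f :: "('a, 'b) ptensor"
  proof transfer
    fix c :: complex and X :: "nat \<Rightarrow> ('a, 'b) atensor"
    assume "ptensor_rel X X"
    then have "(\<lambda>n. norm c * proj_norm (X n)) \<longlonglongrightarrow> norm c * lim (\<lambda>n. proj_norm (X n))"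
      by (intro tendsto_mult_left proj_norm_convergent) (simp add: ptensor_rel_refl)
    then show "lim (\<lambda>n. proj_norm (c *\<^sub>C X n)) = norm c * lim (\<lambda>n. proj_norm (X n))"
      unfolding proj_norm_scaleC by (rule limI)
  qed
  show "norm (r *\<^sub>R f) = \<bar>r\<bar> * norm f"
    by (simp add: norm_scaleC flip: scaleR)
  show "norm (f + g) \<le> norm f + norm g"
  proof transfer
    fix X Y :: "nat \<Rightarrow> ('a, 'b) atensor"
    assume "ptensor_rel X X" and "ptensor_rel Y Y"
    then have "proj_Cauchy X" and "proj_Cauchy Y" by (simp_all add: ptensor_rel_refl)
    then show "lim (\<lambda>n. proj_norm (X n + Y n)) \<le> lim (\<lambda>n. proj_norm (X n)) + lim (\<lambda>n. proj_norm (Y n))"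
      by (intro LIMSEQ_le[OF proj_norm_convergent[OF proj_Cauchy_add]
            tendsto_add[OF proj_norm_convergent proj_norm_convergent]])
        (auto intro: proj_norm_triangle)
  qed
  show "(norm f = 0) = (f = 0)"
  proof transfer
    fix X :: "nat \<Rightarrow> ('a, 'b) atensor"
    assume "ptensor_rel X X"
    then have X: "proj_Cauchy X" by (simp add: ptensor_rel_refl)
    show "(lim (\<lambda>n. proj_norm (X n)) = 0) = ptensor_rel X (\<lambda>_. 0)"
    proof
      assume "lim (\<lambda>n. proj_norm (X n)) = 0"
      with proj_norm_convergent[OF X] have "(\<lambda>n. proj_norm (X n)) \<longlonglongrightarrow> 0" by (simp only:)
      with X show "ptensor_rel X (\<lambda>_. 0)" by (simp add: ptensor_rel_def proj_Cauchy_const)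
    next
      assume "ptensor_rel X (\<lambda>_. 0)"
      then show "lim (\<lambda>n. proj_norm (X n)) = 0" by (intro limI) (simp add: ptensor_rel_def)
    qed
  qed
  show "dist f g = norm (f - g)" by (rule dist_ptensor_def)
  show "sgn f = inverse (norm f) *\<^sub>R f" by (rule sgn_ptensor_def)
  show "uniformity = (INF e\<in>{0 <..}. principal {(x :: ('a, 'b) ptensor, y). dist x y < e})"
    by (rule uniformity_ptensor_def)
  show "open U = (\<forall>x\<in>U. \<forall>\<^sub>F (x', y) in uniformity. x' = x \<longrightarrow> y \<in> U)" for U :: "('a, 'b) ptensor set"
    by (rule open_ptensor_def)
qed

end

definition ptensor_of :: "('a::complex_normed_vector, 'b::complex_normed_vector) atensor \<Rightarrow> ('a, 'b) ptensor" where
  "ptensor_of u = abs_ptensor (\<lambda>_. u)"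

definition tensor :: "'a::complex_normed_vector \<Rightarrow> 'b::complex_normed_vector \<Rightarrow> ('a, 'b) ptensor" (infixr "\<otimes>" 70) where
  "a \<otimes> b = ptensor_of (atens a b)"

lemma norm_ptensor_of: "norm (ptensor_of u) = proj_norm u"
  by (simp add: ptensor_of_def norm_ptensor.abs_eq ptensor_rel_refl proj_Cauchy_const limI)

lemma ptensor_of_add: "ptensor_of (u + v) = ptensor_of u + ptensor_of v"
  by (simp add: ptensor_of_def plus_ptensor.abs_eq ptensor_rel_refl proj_Cauchy_const)

lemma ptensor_of_diff: "ptensor_of (u - v) = ptensor_of u - ptensor_of v"
  by (simp add: ptensor_of_def minus_ptensor.abs_eq ptensor_rel_refl proj_Cauchy_const)

lemma ptensor_of_scaleC: "ptensor_of (c *\<^sub>C u) = c *\<^sub>C ptensor_of u"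
  by (simp add: ptensor_of_def scaleC_ptensor.abs_eq ptensor_rel_refl proj_Cauchy_const)

lemma ptensor_of_zero: "ptensor_of 0 = 0"
  by (simp add: ptensor_of_def zero_ptensor_def)

lemma ptensor_of_sum: "ptensor_of (\<Sum>(a, b)\<leftarrow>xs. atens a b) = (\<Sum>(a, b)\<leftarrow>xs. a \<otimes> b)"
  by (induction xs) (auto simp: ptensor_of_zero ptensor_of_add tensor_def)

lemma ptensor_of_tendsto:
  assumes X: "proj_Cauchy X"
  shows "(\<lambda>n. ptensor_of (X n)) \<longlonglongrightarrow> abs_ptensor X"
proof (rule LIMSEQ_I)
  fix e :: real
  assume "0 < e"
  then have "0 < e / 2" by simp
  then obtain N where N: "\<And>m n. m \<ge> N \<Longrightarrow> n \<ge> N \<Longrightarrow> proj_norm (X m - X n) < e / 2"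
    using X unfolding proj_Cauchy_def by meson
  have "norm (ptensor_of (X n) - abs_ptensor X) < e" if "n \<ge> N" for n
  proof -
    have C: "proj_Cauchy (\<lambda>m. X n - X m)"
      using proj_Cauchy_add[OF proj_Cauchy_const[of "X n"] proj_Cauchy_scaleC[OF X, of "- 1"]]
      by (simp add: scaleC_minus1)
    have "norm (ptensor_of (X n) - abs_ptensor X) = lim (\<lambda>m. proj_norm (X n - X m))"
      using X by (simp add: ptensor_of_def minus_ptensor.abs_eq norm_ptensor.abs_eq C
          ptensor_rel_refl proj_Cauchy_const eq_onp_def)
    also have "\<dots> \<le> e / 2"
      by (rule LIMSEQ_le_const2[OF proj_norm_convergent[OF C]])
        (use N[OF that] in \<open>auto intro!: exI[of _ N] less_imp_le\<close>)
    finally show ?thesis using \<open>0 < e\<close> by simp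
  qed
  then show "\<exists>N. \<forall>n\<ge>N. norm (ptensor_of (X n) - abs_ptensor X) < e" by blast
qed

lemma ptensor_of_approx:
  obtains X where "(\<lambda>n. ptensor_of (X n)) \<longlonglongrightarrow> t"
proof -
  have "proj_Cauchy (rep_ptensor t)"
    using Quotient3_rep_reflp[OF Quotient3_ptensor, of t] by (simp add: ptensor_rel_refl)
  then show ?thesis
    using that ptensor_of_tendsto Quotient3_abs_rep[OF Quotient3_ptensor, of t] by metis
qed

instance ptensor :: (complex_normed_vector, complex_normed_vector) cbanach
proof
  fix T :: "nat \<Rightarrow> ('a, 'b) ptensor"
  assume T: "Cauchy T"
  have "\<exists>u. norm (ptensor_of u - T n) < inverse (real (Suc n))" for n
  proof -
    obtain X where "(\<lambda>k. ptensor_of (X k)) \<longlonglongrightarrow> T n" by (rule ptensor_of_approx)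
    then show ?thesis
      using LIMSEQ_D[of _ _ "inverse (real (Suc n))"] by force
  qed
  then obtain U where U: "\<And>n. norm (ptensor_of (U n) - T n) < inverse (real (Suc n))" by metis
  have diff: "(\<lambda>n. ptensor_of (U n) - T n) \<longlonglongrightarrow> 0"
    by (rule Lim_null_comparison[OF _ LIMSEQ_inverse_real_of_nat])
      (rule always_eventually, rule allI, rule less_imp_le[OF U])
  have "proj_Cauchy U"
    unfolding proj_Cauchy_def
  proof (intro allI impI)
    fix e :: real
    assume "0 < e"
    then have "0 < e / 2" by simp
    then obtain M N where
      M: "\<And>m n. m \<ge> M \<Longrightarrow> n \<ge> M \<Longrightarrow> norm ((ptensor_of (U m) - T m) - (ptensor_of (U n) - T n)) < e / 2"
      and N: "\<And>m n. m \<ge> N \<Longrightarrow> n \<ge> N \<Longrightarrow> norm (T m - T n) < e / 2"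
      using CauchyD[OF LIMSEQ_imp_Cauchy[OF diff]] CauchyD[OF T] by meson
    have "proj_norm (U m - U n) < e" if "m \<ge> max M N" "n \<ge> max M N" for m n
    proof -
      have "ptensor_of (U m - U n)
          = ((ptensor_of (U m) - T m) - (ptensor_of (U n) - T n)) + (T m - T n)"
        by (simp add: ptensor_of_diff)
      then have "proj_norm (U m - U n)
          \<le> norm ((ptensor_of (U m) - T m) - (ptensor_of (U n) - T n)) + norm (T m - T n)"
        by (metis norm_ptensor_of norm_triangle_ineq)
      with M[of m n] N[of m n] that show ?thesis by simp
    qed
    then show "\<exists>N. \<forall>m\<ge>N. \<forall>n\<ge>N. proj_norm (U m - U n) < e" by blast
  qed
  from tendsto_diff[OF ptensor_of_tendsto[OF this] diff]
  have "T \<longlonglongrightarrow> abs_ptensor U" by simp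
  then show "convergent T" by (auto simp: convergent_def)
qed

lemma bounded_cbilinear_tensor: "bounded_cbilinear (\<otimes>)"
  unfolding bounded_cbilinear_def
proof (intro conjI allI)
  show "bounded_bilinear ((\<otimes>) :: 'a \<Rightarrow> 'b \<Rightarrow> _)"
  proof
    show "\<exists>K. \<forall>a b. norm ((a :: 'a) \<otimes> (b :: 'b)) \<le> norm a * norm b * K"
      by (rule exI[of _ 1]) (simp add: tensor_def norm_ptensor_of proj_norm_atens)
    show "(r *\<^sub>R a) \<otimes> b = r *\<^sub>R (a \<otimes> b)" for r and a :: 'a and b :: 'b
      by (simp add: tensor_def atens_scaleC_left ptensor_of_scaleC flip: scaleC_of_real)
    show "a \<otimes> (r *\<^sub>R b) = r *\<^sub>R (a \<otimes> b)" for r and a :: 'a and b :: 'b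
      by (simp add: tensor_def atens_scaleC_right ptensor_of_scaleC flip: scaleC_of_real)
  qed (simp_all add: tensor_def atens_add_left atens_add_right ptensor_of_add)
qed (simp_all add: tensor_def atens_scaleC_left atens_scaleC_right ptensor_of_scaleC)

text \<open>Bounded linear maps on the projective tensor product are determined by their values on
  elementary tensors, and every bounded bilinear map into a Banach space factors.\<close>

lemma bounded_linear_ptensor_eqI:
  fixes f g :: "('a::complex_normed_vector, 'b::complex_normed_vector) ptensor \<Rightarrow> 'c::real_normed_vector"
  assumes f: "bounded_linear f" and g: "bounded_linear g"
    and eq: "\<And>a b. f (a \<otimes> b) = g (a \<otimes> b)"
  shows "f = g"
proof
  fix t :: "('a, 'b) ptensor"
  interpret f: bounded_linear f by (rule f)
  interpret g: bounded_linear g by (rule g)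
  have *: "f (ptensor_of u) = g (ptensor_of u)" for u
    by (induction u rule: atensor_induct)
      (simp_all add: ptensor_of_zero ptensor_of_add f.zero g.zero f.add g.add eq flip: tensor_def)
  obtain X where X: "(\<lambda>n. ptensor_of (X n)) \<longlonglongrightarrow> t" by (rule ptensor_of_approx)
  show "f t = g t"
    by (rule LIMSEQ_unique[OF f.tendsto[OF X]]) (simp add: * g.tendsto[OF X])
qed

lemma ptensor_lift_exists:
  fixes B :: "'a::complex_normed_vector \<Rightarrow> 'b::complex_normed_vector \<Rightarrow> 'c::cbanach"
  assumes B: "bounded_cbilinear B"
  shows "\<exists>L. bounded_clinear L \<and> (\<forall>a b. L (a \<otimes> b) = B a b)"
proof -
  note add = alift_add(1)[OF B] and scale = alift_add(2)[OF B]
  obtain K where K: "0 \<le> K" "\<And>u. norm (alift B u) \<le> K * proj_norm u"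
    using alift_bound[OF B] by blast
  have diff: "alift B (u - v) = alift B u - alift B v" for u v
    using add[of "u - v" v] by simp
  have le: "norm (alift B u - alift B v) \<le> K * norm (ptensor_of u - ptensor_of v)" for u v
    using K(2)[of "u - v"] by (simp add: norm_ptensor_of diff flip: ptensor_of_diff)
  have "\<exists>X. (\<lambda>n. ptensor_of (X n)) \<longlonglongrightarrow> t" for t :: "('a, 'b) ptensor"
  proof -
    obtain X where "(\<lambda>n. ptensor_of (X n)) \<longlonglongrightarrow> t" by (rule ptensor_of_approx)
    then show ?thesis by (rule exI[of _ X])
  qed
  then obtain X where X: "(\<lambda>n. ptensor_of (X t n)) \<longlonglongrightarrow> t" for t :: "('a, 'b) ptensor"
    by metis
  define L where "L t = lim (\<lambda>n. alift B (X t n))" for t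
  have conv: "(\<lambda>n. alift B (X t n)) \<longlonglongrightarrow> L t" for t
  proof -
    have "Cauchy (\<lambda>n. alift B (X t n))"
    proof (rule CauchyI)
      fix e :: real
      assume "0 < e"
      then have "0 < e / (K + 1)" using K(1) by (intro divide_pos_pos) auto
      then obtain N where N: "\<And>m n. m \<ge> N \<Longrightarrow> n \<ge> N \<Longrightarrow>
          norm (ptensor_of (X t m) - ptensor_of (X t n)) < e / (K + 1)"
        using CauchyD[OF LIMSEQ_imp_Cauchy[OF X]] by meson
      have "norm (alift B (X t m) - alift B (X t n)) < e" if "m \<ge> N" "n \<ge> N" for m n
      proof -
        have "norm (alift B (X t m) - alift B (X t n)) \<le> K * norm (ptensor_of (X t m) - ptensor_of (X t n))"
          by (rule le)
        also have "\<dots> \<le> (K + 1) * norm (ptensor_of (X t m) - ptensor_of (X t n))"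
          by (simp add: mult_right_mono)
        also have "\<dots> < (K + 1) * (e / (K + 1))"
          using N[OF that] K(1) by (intro mult_strict_left_mono) auto
        finally show ?thesis using K(1) by simp
      qed
      then show "\<exists>N. \<forall>m\<ge>N. \<forall>n\<ge>N. norm (alift B (X t m) - alift B (X t n)) < e" by blast
    qed
    then show ?thesis by (simp add: L_def Cauchy_convergent_iff convergent_LIMSEQ_iff)
  qed
  have LI: "(\<lambda>n. alift B (Y n)) \<longlonglongrightarrow> L t" if Y: "(\<lambda>n. ptensor_of (Y n)) \<longlonglongrightarrow> t" for Y t
  proof -
    have "(\<lambda>n. K * norm (ptensor_of (Y n) - ptensor_of (X t n))) \<longlonglongrightarrow> 0"
      using tendsto_mult_right_zero[OF tendsto_norm_zero[OF tendsto_diff[OF Y X[of t], simplified]]] by simp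
    then have "(\<lambda>n. alift B (Y n) - alift B (X t n)) \<longlonglongrightarrow> 0"
      by (rule Lim_null_comparison[OF always_eventually, rotated]) (simp add: le)
    from tendsto_add[OF this conv[of t]] show ?thesis by simp
  qed
  have L_add: "L (s + t) = L s + L t" for s t
  proof (rule LIMSEQ_unique[OF LI])
    show "(\<lambda>n. ptensor_of (X s n + X t n)) \<longlonglongrightarrow> s + t"
      using tendsto_add[OF X X] by (simp add: ptensor_of_add)
    show "(\<lambda>n. alift B (X s n + X t n)) \<longlonglongrightarrow> L s + L t"
      using tendsto_add[OF conv conv] by (simp add: add)
  qed
  have L_scale: "L (c *\<^sub>C t) = c *\<^sub>C L t" for c t
  proof (rule LIMSEQ_unique[OF LI])
    show "(\<lambda>n. ptensor_of (c *\<^sub>C X t n)) \<longlonglongrightarrow> c *\<^sub>C t"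
      using tendsto_scaleC[OF X] by (simp add: ptensor_of_scaleC)
    show "(\<lambda>n. alift B (c *\<^sub>C X t n)) \<longlonglongrightarrow> c *\<^sub>C L t"
      using tendsto_scaleC[OF conv] by (simp add: scale)
  qed
  have L_bound: "norm (L t) \<le> norm t * K" for t
  proof (rule LIMSEQ_le)
    show "(\<lambda>n. norm (alift B (X t n))) \<longlonglongrightarrow> norm (L t)"
      by (rule tendsto_norm[OF conv])
    show "(\<lambda>n. norm (ptensor_of (X t n)) * K) \<longlonglongrightarrow> norm t * K"
      by (intro tendsto_mult_right tendsto_norm X)
    show "\<exists>N. \<forall>n\<ge>N. norm (alift B (X t n)) \<le> norm (ptensor_of (X t n)) * K"
      using K(2) by (simp add: norm_ptensor_of mult.commute)
  qed
  have "bounded_linear L"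
    by (rule bounded_linear_intro[where K = K])
      (simp_all add: L_add L_bound L_scale flip: scaleC_of_real)
  moreover have "L (a \<otimes> b) = B a b" for a b
    by (rule LIMSEQ_unique[OF LI[of "\<lambda>_. atens a b"]])
      (simp_all add: tensor_def alift_add(3)[OF B])
  ultimately show ?thesis by (auto simp: bounded_clinear_def L_scale)
qed

definition ptensor_lift ::
    "('a::complex_normed_vector \<Rightarrow> 'b::complex_normed_vector \<Rightarrow> 'c::cbanach) \<Rightarrow> ('a, 'b) ptensor \<Rightarrow> 'c" where
  "ptensor_lift B = (THE L. bounded_clinear L \<and> (\<forall>a b. L (a \<otimes> b) = B a b))"

lemma ptensor_lift:
  assumes "bounded_cbilinear B"
  shows "bounded_clinear (ptensor_lift B)" and "ptensor_lift B (a \<otimes> b) = B a b"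
proof -
  have "\<exists>!L. bounded_clinear L \<and> (\<forall>a b. L (a \<otimes> b) = B a b)"
    using ptensor_lift_exists[OF assms]
    by (rule ex_ex1I) (auto simp: bounded_clinear_def intro: bounded_linear_ptensor_eqI)
  from theI'[OF this] show "bounded_clinear (ptensor_lift B)" and "ptensor_lift B (a \<otimes> b) = B a b"
    by (simp_all add: ptensor_lift_def)
qed


lemma norm_ptensor_lift_le:
  assumes B: "bounded_cbilinear B" and K: "0 \<le> K" "\<And>a b. norm (B a b) \<le> K * (norm a * norm b)"
  shows "norm (ptensor_lift B t) \<le> K * norm t"
proof -
  interpret bounded_linear "ptensor_lift B"
    using ptensor_lift(1)[OF B] by (simp add: bounded_clinear_def)
  have *: "norm (ptensor_lift B (ptensor_of u)) \<le> K * norm (ptensor_of u)" for u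
  proof (rule field_le_epsilon)
    fix e :: real
    assume "0 < e"
    with K(1) have "0 < e / (K + 1)" by simp
    then obtain xs where xs: "u = (\<Sum>(a, b)\<leftarrow>xs. atens a b)"
      "(\<Sum>(a, b)\<leftarrow>xs. norm a * norm b) < proj_norm u + e / (K + 1)"
      by (rule proj_norm_approx)
    have eq: "ptensor_of u = (\<Sum>(a, b)\<leftarrow>xs. a \<otimes> b)"
      unfolding xs(1) by (rule ptensor_of_sum)
    have "norm (ptensor_lift B (ptensor_of u)) \<le> K * (\<Sum>(a, b)\<leftarrow>xs. norm a * norm b)"
      unfolding eq
    proof (induction xs)
      case (Cons x xs)
      obtain a b where x: "x = (a, b)" by (cases x)
      have "norm (ptensor_lift B (\<Sum>(a, b)\<leftarrow>x # xs. a \<otimes> b))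
          \<le> norm (B a b) + norm (ptensor_lift B (\<Sum>(a, b)\<leftarrow>xs. a \<otimes> b))"
        by (simp add: x add ptensor_lift(2)[OF B] norm_triangle_ineq)
      with Cons K(2)[of a b] show ?case by (simp add: x algebra_simps)
    qed (simp add: zero)
    also have "\<dots> \<le> K * (proj_norm u + e / (K + 1))"
      using xs(2) K(1) by (intro mult_left_mono) auto
    also have "\<dots> = K * proj_norm u + e * (K / (K + 1))"
      by (simp add: algebra_simps)
    also have "e * (K / (K + 1)) \<le> e * 1"
      using \<open>0 < e\<close> K(1) by (intro mult_left_mono) (auto simp: divide_le_eq)
    finally show "norm (ptensor_lift B (ptensor_of u)) \<le> K * norm (ptensor_of u) + e"
      by (simp add: norm_ptensor_of)
  qed
  obtain X where X: "(\<lambda>n. ptensor_of (X n)) \<longlonglongrightarrow> t" by (rule ptensor_of_approx)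
  show ?thesis
    by (rule LIMSEQ_le[OF tendsto_norm[OF tendsto[OF X]] tendsto_mult_left[OF tendsto_norm[OF X]]])
      (use * in blast)
qed

section \<open>Nets\<close>

text \<open>A net is a family indexed by a nonempty set \<open>D\<close> with a directed preorder \<open>le\<close>; it converges
  iff it converges along the filter generated by the tails of \<open>D\<close>.\<close>

definition directed_index :: "'i set \<Rightarrow> ('i \<Rightarrow> 'i \<Rightarrow> bool) \<Rightarrow> bool" where
  "directed_index D le \<longleftrightarrow> D \<noteq> {} \<and> (\<forall>d\<in>D. le d d)
     \<and> (\<forall>d\<in>D. \<forall>e\<in>D. \<forall>f\<in>D. le d e \<longrightarrow> le e f \<longrightarrow> le d f)
     \<and> (\<forall>d\<in>D. \<forall>e\<in>D. \<exists>f\<in>D. le d f \<and> le e f)"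

definition net_filter :: "'i set \<Rightarrow> ('i \<Rightarrow> 'i \<Rightarrow> bool) \<Rightarrow> 'i filter" where
  "net_filter D le = (INF d\<in>D. principal {e \<in> D. le d e})"

lemma eventually_net_filter:
  assumes "directed_index D le"
  shows "eventually P (net_filter D le) \<longleftrightarrow> (\<exists>d\<in>D. \<forall>e\<in>D. le d e \<longrightarrow> P e)"
proof -
  have "eventually P (net_filter D le) \<longleftrightarrow> (\<exists>d\<in>D. eventually P (principal {e \<in> D. le d e}))"
    unfolding net_filter_def
  proof (rule eventually_INF_base)
    show "D \<noteq> {}" using assms by (simp add: directed_index_def)
    fix d e
    assume "d \<in> D" and "e \<in> D"
    then obtain f where f: "f \<in> D" "le d f" "le e f"
      using assms unfolding directed_index_def by meson
    have "le d x" "le e x" if "x \<in> D" "le f x" for x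
      using assms \<open>d \<in> D\<close> \<open>e \<in> D\<close> f that unfolding directed_index_def by blast+
    with f(1) show "\<exists>f\<in>D. principal {x \<in> D. le f x} \<le> inf (principal {x \<in> D. le d x}) (principal {x \<in> D. le e x})"
      by (intro bexI[of _ f]) auto
  qed
  then show ?thesis by (auto simp: eventually_principal)
qed

text \<open>HOL cannot quantify over the index type inside a formula. For nets in a type \<open>'x\<close> it is
  enough to allow index sets contained in the following type: a net over any index type takes the
  same values, and has the same convergence behaviour, as one indexed in this way.\<close>

type_synonym 'x net_index = "'x \<times> 'x set"

lemma net_reindex:
  fixes D :: "'i set" and m :: "'i \<Rightarrow> 'x"
  assumes D: "directed_index D le"
  shows "\<exists>(D' :: 'x net_index set) le' m'. directed_index D' le' \<and> m' ` D' \<subseteq> m ` D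
    \<and> filtermap m' (net_filter D' le') = filtermap m (net_filter D le)"
proof -
  define T where "T d = m ` {e \<in> D. le d e}" for d
  define D' where "D' = {(x, S). x \<in> S \<and> (\<exists>d\<in>D. S = T d)}"
  define le' where "le' p q \<longleftrightarrow> snd q \<subseteq> snd p" for p q :: "'x net_index"
  from D have ne: "D \<noteq> {}" and refl: "\<And>d. d \<in> D \<Longrightarrow> le d d"
    and trans: "\<And>d e f. d \<in> D \<Longrightarrow> e \<in> D \<Longrightarrow> f \<in> D \<Longrightarrow> le d e \<Longrightarrow> le e f \<Longrightarrow> le d f"
    and dir: "\<And>d e. d \<in> D \<Longrightarrow> e \<in> D \<Longrightarrow> \<exists>f\<in>D. le d f \<and> le e f"
    unfolding directed_index_def by blast+
  have T: "m d \<in> T d" if "d \<in> D" for d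
    using refl[OF that] that by (auto simp: T_def)
  have T_sub: "T e \<subseteq> T d" if "le d e" "d \<in> D" "e \<in> D" for d e
    using trans[OF that(2,3) _ that(1)] by (auto simp: T_def)
  have mem: "(x, T d) \<in> D'" if "d \<in> D" "x \<in> T d" for x d
    using that by (auto simp: D'_def)
  have "directed_index D' le'"
    unfolding directed_index_def
  proof (intro conjI ballI)
    show "D' \<noteq> {}"
      using ne mem T by blast
    fix p q
    assume "p \<in> D'" "q \<in> D'"
    then obtain d e where d: "d \<in> D" "snd p = T d" and e: "e \<in> D" "snd q = T e"
      by (auto simp: D'_def)
    obtain f where f: "f \<in> D" "le d f" "le e f"
      using dir[OF d(1) e(1)] by blast
    show "\<exists>r\<in>D'. le' p r \<and> le' q r"
      using T_sub[OF f(2) d(1) f(1)] T_sub[OF f(3) e(1) f(1)] d(2) e(2)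
      by (intro bexI[OF _ mem[OF f(1) T[OF f(1)]]]) (simp add: le'_def)
  qed (auto simp: le'_def)
  moreover have "fst ` D' \<subseteq> m ` D"
    by (auto simp: D'_def T_def)
  moreover have "filtermap fst (net_filter D' le') = filtermap m (net_filter D le)"
  proof (rule filter_eqI)
    fix P
    have "(\<exists>p\<in>D'. \<forall>q\<in>D'. le' p q \<longrightarrow> P (fst q)) \<longleftrightarrow> (\<exists>d\<in>D. \<forall>x\<in>T d. P x)"
    proof
      assume "\<exists>p\<in>D'. \<forall>q\<in>D'. le' p q \<longrightarrow> P (fst q)"
      then obtain p where p: "p \<in> D'" "\<And>q. q \<in> D' \<Longrightarrow> le' p q \<Longrightarrow> P (fst q)" by blast
      then obtain d where d: "d \<in> D" "snd p = T d" by (auto simp: D'_def)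
      have "P x" if "x \<in> T d" for x
        using p(2)[OF mem[OF d(1) that]] d(2) by (simp add: le'_def)
      with d show "\<exists>d\<in>D. \<forall>x\<in>T d. P x" by blast
    next
      assume "\<exists>d\<in>D. \<forall>x\<in>T d. P x"
      then obtain d where d: "d \<in> D" "\<And>x. x \<in> T d \<Longrightarrow> P x" by blast
      then show "\<exists>p\<in>D'. \<forall>q\<in>D'. le' p q \<longrightarrow> P (fst q)"
        by (intro bexI[OF _ mem[OF d(1) T[OF d(1)]]]) (auto simp: D'_def le'_def)
    qed
    also have "\<dots> \<longleftrightarrow> (\<exists>d\<in>D. \<forall>e\<in>D. le d e \<longrightarrow> P (m e))"
      by (auto simp: T_def)
    finally show "eventually P (filtermap fst (net_filter D' le')) = eventually P (filtermap m (net_filter D le))"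
      by (simp add: eventually_filtermap eventually_net_filter D \<open>directed_index D' le'\<close>)
  qed
  ultimately show ?thesis
    by (intro exI[of _ D'] exI[of _ le'] exI[of _ fst] conjI)
qed

section \<open>Banach bimodules\<close>

definition banach_bimodule ::
    "('a::complex_banach_algebra \<Rightarrow> 'x::cbanach \<Rightarrow> 'x) \<Rightarrow> ('x \<Rightarrow> 'a \<Rightarrow> 'x) \<Rightarrow> bool" where
  "banach_bimodule l r \<longleftrightarrow> bounded_cbilinear l \<and> bounded_cbilinear r
     \<and> (\<forall>a b x. l (a * b) x = l a (l b x)) \<and> (\<forall>a b x. r x (a * b) = r (r x a) b)
     \<and> (\<forall>a b x. l a (r x b) = r (l a x) b)"

definition ptensor_lact :: "'a::complex_banach_algebra \<Rightarrow> ('a, 'a) ptensor \<Rightarrow> ('a, 'a) ptensor" where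
  "ptensor_lact a = ptensor_lift (\<lambda>b c. (a * b) \<otimes> c)"

definition ptensor_ract :: "('a, 'a) ptensor \<Rightarrow> 'a::complex_banach_algebra \<Rightarrow> ('a, 'a) ptensor" where
  "ptensor_ract t a = ptensor_lift (\<lambda>b c. b \<otimes> (c * a)) t"

definition product_map :: "('a::complex_banach_algebra, 'a) ptensor \<Rightarrow> 'a" where
  "product_map = ptensor_lift (*)"

text \<open>The dual actions: \<open>\<langle>x, a \<cdot> \<phi>\<rangle> = \<langle>x \<cdot> a, \<phi>\<rangle>\<close> and \<open>\<langle>x, \<phi> \<cdot> a\<rangle> = \<langle>a \<cdot> x, \<phi>\<rangle>\<close>.\<close>

definition dual_lact :: "('x::complex_normed_vector \<Rightarrow> 'a \<Rightarrow> 'x) \<Rightarrow> 'a \<Rightarrow> 'x cdual \<Rightarrow> 'x cdual" where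
  "dual_lact r a \<phi> = dual_map (\<lambda>x. r x a) \<phi>"

definition dual_ract :: "('a \<Rightarrow> 'x::complex_normed_vector \<Rightarrow> 'x) \<Rightarrow> 'x cdual \<Rightarrow> 'a \<Rightarrow> 'x cdual" where
  "dual_ract l \<phi> a = dual_map (\<lambda>x. l a x) \<phi>"

lemma bounded_cbilinear_mult: "bounded_cbilinear ((*) :: 'a::complex_normed_algebra \<Rightarrow> _)"
  by (simp add: bounded_cbilinear_def bounded_bilinear_mult mult_scaleC_left mult_scaleC_right)

lemma bounded_cbilinear_compose:
  assumes B: "bounded_cbilinear B" and f: "bounded_clinear f" and g: "bounded_clinear g"
  shows "bounded_cbilinear (\<lambda>x y. B (f x) (g y))"
  using assms unfolding bounded_cbilinear_def bounded_clinear_def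
  by (auto intro: bounded_bilinear.comp)

lemma bounded_clinear_ident: "bounded_clinear (\<lambda>x. x)"
  by (simp add: bounded_clinear_def bounded_linear_ident)

lemma bounded_cbilinear_ptensor_acts:
  fixes a :: "'a::complex_banach_algebra"
  shows "bounded_cbilinear (\<lambda>b c. (a * b) \<otimes> (c :: 'a))"
    and "bounded_cbilinear (\<lambda>b c. (b :: 'a) \<otimes> (c * a))"
  by (intro bounded_cbilinear_compose[OF bounded_cbilinear_tensor] bounded_clinear_ident
      bounded_cbilinear_clinear[OF bounded_cbilinear_mult])+

lemma bounded_clinear_ptensor_lact: "bounded_clinear (ptensor_lact a)"
  unfolding ptensor_lact_def by (rule ptensor_lift(1)[OF bounded_cbilinear_ptensor_acts(1)])

lemma bounded_clinear_ptensor_ract: "bounded_clinear (\<lambda>t. ptensor_ract t a)"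
  unfolding ptensor_ract_def using ptensor_lift(1)[OF bounded_cbilinear_ptensor_acts(2)] .

lemma ptensor_lact_tensor [simp]: "ptensor_lact a (b \<otimes> c) = (a * b) \<otimes> c"
  unfolding ptensor_lact_def by (rule ptensor_lift(2)[OF bounded_cbilinear_ptensor_acts(1)])

lemma ptensor_ract_tensor [simp]: "ptensor_ract (b \<otimes> c) a = b \<otimes> (c * a)"
  unfolding ptensor_ract_def by (rule ptensor_lift(2)[OF bounded_cbilinear_ptensor_acts(2)])

lemma bounded_clinear_product_map: "bounded_clinear product_map"
  unfolding product_map_def by (rule ptensor_lift(1)[OF bounded_cbilinear_mult])

lemma product_map_tensor [simp]: "product_map (a \<otimes> b) = a * b"
  unfolding product_map_def by (rule ptensor_lift(2)[OF bounded_cbilinear_mult])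

lemma norm_tensor_le: "norm (a \<otimes> b) \<le> norm a * norm b"
  by (simp add: tensor_def norm_ptensor_of proj_norm_atens)

lemma bounded_cbilinearI:
  fixes B :: "'a::complex_normed_vector \<Rightarrow> 'b::complex_normed_vector \<Rightarrow> 'c::complex_normed_vector"
  assumes "\<And>x x' y. B (x + x') y = B x y + B x' y" and "\<And>x y y'. B x (y + y') = B x y + B x y'"
    and "\<And>c x y. B (c *\<^sub>C x) y = c *\<^sub>C B x y" and "\<And>c x y. B x (c *\<^sub>C y) = c *\<^sub>C B x y"
    and "\<And>x y. norm (B x y) \<le> K * (norm x * norm y)"
  shows "bounded_cbilinear B"
  unfolding bounded_cbilinear_def
proof (intro conjI allI)
  show "bounded_bilinear B"
  proof
    show "\<exists>K. \<forall>a b. norm (B a b) \<le> norm a * norm b * K"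
      using assms(5) by (intro exI[of _ K] allI) (metis mult.commute)
  qed (simp_all add: assms flip: scaleC_of_real)
qed (simp_all add: assms)

lemma bounded_cbilinearD:
  assumes "bounded_cbilinear B"
  shows "B (x + x') y = B x y + B x' y" and "B x (y + y') = B x y + B x y'"
    and "B (c *\<^sub>C x) y = c *\<^sub>C B x y" and "B x (c *\<^sub>C y) = c *\<^sub>C B x y"
  using assms
  by (simp_all add: bounded_cbilinear_def bounded_bilinear.add_left[of B] bounded_bilinear.add_right[of B])

lemmas tensor_simps = bounded_cbilinearD[OF bounded_cbilinear_tensor]
lemmas pairing_simps = bounded_cbilinearD[OF bounded_cbilinear_pairing, unfolded scaleC_complex_def]

lemma banach_bimodule_self: "banach_bimodule (*) ((*) :: 'a::complex_banach_algebra \<Rightarrow> _)"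
  by (simp add: banach_bimodule_def bounded_cbilinear_mult mult.assoc)

lemma banach_bimodule_ptensor:
  "banach_bimodule ptensor_lact (ptensor_ract :: _ \<Rightarrow> 'a::complex_banach_algebra \<Rightarrow> _)"
proof -
  let ?T = "\<lambda>f. bounded_linear (f :: ('a, 'a) ptensor \<Rightarrow> ('a, 'a) ptensor)"
  have bl: "?T (ptensor_lact a)" and br: "?T (\<lambda>t. ptensor_ract t a)" for a
    using bounded_clinear_ptensor_lact bounded_clinear_ptensor_ract by (auto simp: bounded_clinear_def)
  have bc: "?T (\<lambda>t. f (g t))" if "?T f" "?T g" for f g
    using bounded_linear_compose[OF that] .
  have bs: "?T (\<lambda>t. c *\<^sub>C f t)" if "?T f" for f c
    using bounded_linear_compose[OF bounded_linear_scaleC that] .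
  note ext = bounded_linear_ptensor_eqI[THEN fun_cong]
  note alg = tensor_simps distrib_left distrib_right mult_scaleC_left mult_scaleC_right mult.assoc
  have l: "bounded_cbilinear (ptensor_lact :: 'a \<Rightarrow> _)"
  proof (rule bounded_cbilinearI[where K = 1])
    fix a a' :: 'a and t t' :: "('a, 'a) ptensor" and c
    show "ptensor_lact (a + a') t = ptensor_lact a t + ptensor_lact a' t"
      by (rule ext[OF bl bounded_linear_add[OF bl bl]]) (simp add: alg)
    show "ptensor_lact (c *\<^sub>C a) t = c *\<^sub>C ptensor_lact a t"
      by (rule ext[OF bl bs[OF bl]]) (simp add: alg)
    show "ptensor_lact a (t + t') = ptensor_lact a t + ptensor_lact a t'"
      by (rule linear_add) (rule bounded_linear.linear[OF bl])
    show "ptensor_lact a (c *\<^sub>C t) = c *\<^sub>C ptensor_lact a t"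
      using bounded_clinear_ptensor_lact[of a] by (simp add: bounded_clinear_def)
    have "norm ((a * b) \<otimes> d) \<le> norm a * (norm b * norm d)" for b d :: 'a
      using norm_tensor_le[of "a * b" d] mult_right_mono[OF norm_mult_ineq[of a b] norm_ge_zero[of d]]
      by (simp add: mult.assoc)
    then show "norm (ptensor_lact a t) \<le> 1 * (norm a * norm t)"
      unfolding ptensor_lact_def
      by (simp add: norm_ptensor_lift_le[OF bounded_cbilinear_ptensor_acts(1)])
  qed
  have r: "bounded_cbilinear (ptensor_ract :: _ \<Rightarrow> 'a \<Rightarrow> _)"
  proof (rule bounded_cbilinearI[where K = 1])
    fix a a' :: 'a and t t' :: "('a, 'a) ptensor" and c
    show "ptensor_ract t (a + a') = ptensor_ract t a + ptensor_ract t a'"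
      by (rule ext[OF br bounded_linear_add[OF br br]]) (simp add: alg)
    show "ptensor_ract t (c *\<^sub>C a) = c *\<^sub>C ptensor_ract t a"
      by (rule ext[OF br bs[OF br]]) (simp add: alg)
    show "ptensor_ract (t + t') a = ptensor_ract t a + ptensor_ract t' a"
      using linear_add[OF bounded_linear.linear[OF br]] .
    show "ptensor_ract (c *\<^sub>C t) a = c *\<^sub>C ptensor_ract t a"
      using bounded_clinear_ptensor_ract[of a] by (simp add: bounded_clinear_def)
    have "norm (b \<otimes> (d * a)) \<le> norm a * (norm b * norm d)" for b d :: 'a
      using norm_tensor_le[of b "d * a"] mult_left_mono[OF norm_mult_ineq[of d a] norm_ge_zero[of b]]
      by (simp add: mult_ac)
    then show "norm (ptensor_ract t a) \<le> 1 * (norm t * norm a)"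
      unfolding ptensor_ract_def
      using norm_ptensor_lift_le[OF bounded_cbilinear_ptensor_acts(2), of "norm a" a t]
      by (simp add: mult.commute)
  qed
  have "ptensor_lact (a * b) t = ptensor_lact a (ptensor_lact b t)" for a b :: 'a and t
    by (rule ext[OF bl bc[OF bl bl]]) (simp add: alg)
  moreover have "ptensor_ract t (a * b) = ptensor_ract (ptensor_ract t a) b" for a b :: 'a and t
    by (rule ext[OF br bc[OF br br]]) (simp add: alg)
  moreover have "ptensor_lact a (ptensor_ract t b) = ptensor_ract (ptensor_lact a t) b" for a b :: 'a and t
    by (rule ext[OF bc[OF bl br] bc[OF br bl]]) (simp add: alg)
  ultimately show ?thesis by (simp add: banach_bimodule_def l r)
qed

lemma pairing_dual_acts:
  assumes "banach_bimodule l r"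
  shows "\<langle>x, dual_lact r a \<phi>\<rangle> = \<langle>r x a, \<phi>\<rangle>" and "\<langle>x, dual_ract l \<phi> a\<rangle> = \<langle>l a x, \<phi>\<rangle>"
  using assms
  by (auto simp: banach_bimodule_def dual_lact_def dual_ract_def pairing_dual_map bounded_cbilinear_clinear)

lemma banach_bimodule_dual:
  fixes l :: "'a::complex_banach_algebra \<Rightarrow> 'x::cbanach \<Rightarrow> 'x"
  assumes "banach_bimodule l r"
  shows "banach_bimodule (dual_lact r) (dual_ract l)"
proof -
  note p = pairing_dual_acts[OF assms]
  have l: "bounded_cbilinear l" and r: "bounded_cbilinear r"
    and assoc: "l (a * b) x = l a (l b x)" "r x (a * b) = r (r x a) b" "l a (r x b) = r (l a x) b" for a b x
    using assms by (auto simp: banach_bimodule_def)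
  interpret l: bounded_bilinear l using l by (simp add: bounded_cbilinear_def)
  interpret r: bounded_bilinear r using r by (simp add: bounded_cbilinear_def)
  have h: "l (c *\<^sub>C a) x = c *\<^sub>C l a x" "r x (c *\<^sub>C a) = c *\<^sub>C r x a" for c a x
    using l r by (auto simp: bounded_cbilinear_def)
  obtain Kl where Kl: "0 < Kl" "\<And>a x. norm (l a x) \<le> norm a * norm x * Kl" using l.pos_bounded by blast
  obtain Kr where Kr: "0 < Kr" "\<And>x a. norm (r x a) \<le> norm x * norm a * Kr" using r.pos_bounded by blast
  have "bounded_cbilinear (dual_lact r)"
  proof (rule bounded_cbilinearI[where K = Kr])
    show "norm (dual_lact r a \<phi>) \<le> Kr * (norm a * norm \<phi>)" for a \<phi>
    proof (rule norm_cdual_bound)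
      show "norm \<langle>x, dual_lact r a \<phi>\<rangle> \<le> Kr * (norm a * norm \<phi>) * norm x" for x
        using pairing_norm[of "r x a" \<phi>] mult_left_mono[OF Kr(2)[of x a] norm_ge_zero[of \<phi>]]
        by (simp add: p mult_ac)
    qed (use Kr(1) in simp)
  qed (rule cdual_eqI, simp add: p pairing_simps h r.add_right)+
  moreover have "bounded_cbilinear (dual_ract l)"
  proof (rule bounded_cbilinearI[where K = Kl])
    show "norm (dual_ract l \<phi> a) \<le> Kl * (norm \<phi> * norm a)" for a \<phi>
    proof (rule norm_cdual_bound)
      show "norm \<langle>x, dual_ract l \<phi> a\<rangle> \<le> Kl * (norm \<phi> * norm a) * norm x" for x
        using pairing_norm[of "l a x" \<phi>] mult_left_mono[OF Kl(2)[of a x] norm_ge_zero[of \<phi>]]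
        by (simp add: p mult_ac)
    qed (use Kl(1) in simp)
  qed (rule cdual_eqI, simp add: p pairing_simps h l.add_left)+
  ultimately show ?thesis
    unfolding banach_bimodule_def by (auto intro!: cdual_eqI simp: p assoc)
qed

definition bimodule_morphism ::
    "('a \<Rightarrow> 'x::complex_normed_vector \<Rightarrow> 'x) \<Rightarrow> ('x \<Rightarrow> 'a \<Rightarrow> 'x)
     \<Rightarrow> ('a \<Rightarrow> 'y::complex_normed_vector \<Rightarrow> 'y) \<Rightarrow> ('y \<Rightarrow> 'a \<Rightarrow> 'y) \<Rightarrow> ('x \<Rightarrow> 'y) \<Rightarrow> bool" where
  "bimodule_morphism lX rX lY rY \<theta> \<longleftrightarrow> bounded_clinear \<theta>
     \<and> (\<forall>a x. \<theta> (lX a x) = lY a (\<theta> x)) \<and> (\<forall>a x. \<theta> (rX x a) = rY (\<theta> x) a)"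

definition approx_bimodule_morphism ::
    "('a \<Rightarrow> 'x::complex_normed_vector \<Rightarrow> 'x) \<Rightarrow> ('x \<Rightarrow> 'a \<Rightarrow> 'x)
     \<Rightarrow> ('a \<Rightarrow> 'y::complex_normed_vector \<Rightarrow> 'y) \<Rightarrow> ('y \<Rightarrow> 'a \<Rightarrow> 'y)
     \<Rightarrow> 'i set \<Rightarrow> ('i \<Rightarrow> 'i \<Rightarrow> bool) \<Rightarrow> ('i \<Rightarrow> 'x \<Rightarrow> 'y) \<Rightarrow> bool" where
  "approx_bimodule_morphism lX rX lY rY D le \<theta> \<longleftrightarrow> directed_index D le
     \<and> (\<forall>d\<in>D. bounded_clinear (\<theta> d))
     \<and> (\<forall>a x. ((\<lambda>d. norm (\<theta> d (lX a x) - lY a (\<theta> d x))) \<longlongrightarrow> 0) (net_filter D le))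
     \<and> (\<forall>a x. ((\<lambda>d. norm (\<theta> d (rX x a) - rY (\<theta> d x) a)) \<longlongrightarrow> 0) (net_filter D le))"

text \<open>The target is the dual of the bimodule with actions \<open>lF\<close> and \<open>rF\<close>.\<close>

definition wstar_approx_bimodule_morphism ::
    "('a \<Rightarrow> 'x::complex_normed_vector \<Rightarrow> 'x) \<Rightarrow> ('x \<Rightarrow> 'a \<Rightarrow> 'x)
     \<Rightarrow> ('a \<Rightarrow> 'f::complex_normed_vector \<Rightarrow> 'f) \<Rightarrow> ('f \<Rightarrow> 'a \<Rightarrow> 'f)
     \<Rightarrow> 'i set \<Rightarrow> ('i \<Rightarrow> 'i \<Rightarrow> bool) \<Rightarrow> ('i \<Rightarrow> 'x \<Rightarrow> 'f cdual) \<Rightarrow> bool" where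
  "wstar_approx_bimodule_morphism lX rX lF rF D le \<theta> \<longleftrightarrow> directed_index D le
     \<and> (\<forall>d\<in>D. bounded_clinear (\<theta> d))
     \<and> (\<forall>a x f. ((\<lambda>d. \<langle>f, \<theta> d (lX a x) - dual_lact rF a (\<theta> d x)\<rangle>) \<longlongrightarrow> 0) (net_filter D le))
     \<and> (\<forall>a x f. ((\<lambda>d. \<langle>f, \<theta> d (rX x a) - dual_ract lF (\<theta> d x) a\<rangle>) \<longlongrightarrow> 0) (net_filter D le))"

text \<open>Convergence \<open>\<theta> d \<rightarrow> T\<close> in the \<open>W\<^sup>*OT\<close> topology.\<close>

definition wstar_ot_tendsto ::
    "('i \<Rightarrow> 'e::complex_normed_vector \<Rightarrow> 'f::complex_normed_vector cdual) \<Rightarrow> ('e \<Rightarrow> 'f cdual) \<Rightarrow> 'i filter \<Rightarrow> bool" where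
  "wstar_ot_tendsto \<theta> T F \<longleftrightarrow> (\<forall>e f. ((\<lambda>d. norm \<langle>f, \<theta> d e - T e\<rangle>) \<longlongrightarrow> 0) F)"

section \<open>Pseudo-amenability, approximate biflatness and approximate identities\<close>

definition pseudo_amenable :: "'a::complex_banach_algebra itself \<Rightarrow> bool" where
  "pseudo_amenable TYPE('a) \<longleftrightarrow>
     (\<exists>(D :: ('a, 'a) ptensor net_index set) le (m :: _ \<Rightarrow> ('a, 'a) ptensor). directed_index D le
       \<and> (\<forall>a. ((\<lambda>d. ptensor_lact a (m d) - ptensor_ract (m d) a) \<longlongrightarrow> 0) (net_filter D le))
       \<and> (\<forall>a. ((\<lambda>d. product_map (m d) * a) \<longlongrightarrow> a) (net_filter D le)))"

definition has_approx_splitting :: "'a::complex_banach_algebra itself \<Rightarrow> bool" where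
  "has_approx_splitting TYPE('a) \<longleftrightarrow>
     (\<exists>(D :: ('a \<Rightarrow> ('a, 'a) ptensor) net_index set) le (\<beta> :: _ \<Rightarrow> 'a \<Rightarrow> ('a, 'a) ptensor).
       approx_bimodule_morphism (*) (*) ptensor_lact ptensor_ract D le \<beta>
       \<and> (\<forall>a. ((\<lambda>d. norm (product_map (\<beta> d a) - a)) \<longlongrightarrow> 0) (net_filter D le)))"

definition has_wstar_approx_splitting :: "'a::complex_banach_algebra itself \<Rightarrow> bool" where
  "has_wstar_approx_splitting TYPE('a) \<longleftrightarrow>
     (\<exists>(D :: (('a, 'a) ptensor cdual \<Rightarrow> 'a cdual) net_index set) le
       (\<theta> :: _ \<Rightarrow> ('a, 'a) ptensor cdual \<Rightarrow> 'a cdual).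
       wstar_approx_bimodule_morphism (dual_lact ptensor_ract) (dual_ract ptensor_lact) (*) (*) D le \<theta>
       \<and> wstar_ot_tendsto (\<lambda>d. \<theta> d \<circ> dual_map product_map) id (net_filter D le))"

definition approx_biflat :: "'a::complex_banach_algebra itself \<Rightarrow> bool" where
  "approx_biflat TYPE('a) \<longleftrightarrow>
     (\<exists>(D :: (('a, 'a) ptensor cdual \<Rightarrow> 'a cdual) net_index set) le
       (\<theta> :: _ \<Rightarrow> ('a, 'a) ptensor cdual \<Rightarrow> 'a cdual). directed_index D le
       \<and> (\<forall>d\<in>D. bimodule_morphism (dual_lact ptensor_ract) (dual_ract ptensor_lact)
             (dual_lact (*)) (dual_ract (*)) (\<theta> d))
       \<and> wstar_ot_tendsto (\<lambda>d. \<theta> d \<circ> dual_map product_map) id (net_filter D le))"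

definition approx_identity ::
    "'i set \<Rightarrow> ('i \<Rightarrow> 'i \<Rightarrow> bool) \<Rightarrow> ('i \<Rightarrow> 'a::complex_banach_algebra) \<Rightarrow> bool" where
  "approx_identity D le e \<longleftrightarrow> directed_index D le
     \<and> (\<forall>a. ((\<lambda>d. e d * a) \<longlongrightarrow> a) (net_filter D le)) \<and> (\<forall>a. ((\<lambda>d. a * e d) \<longlongrightarrow> a) (net_filter D le))"

definition has_approx_identity :: "'a::complex_banach_algebra itself \<Rightarrow> bool" where
  "has_approx_identity TYPE('a) \<longleftrightarrow>
     (\<exists>(D :: 'a net_index set) le (e :: _ \<Rightarrow> 'a). approx_identity D le e)"

definition has_central_approx_identity :: "'a::complex_banach_algebra itself \<Rightarrow> bool" where
  "has_central_approx_identity TYPE('a) \<longleftrightarrow>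
     (\<exists>(D :: 'a net_index set) le (e :: _ \<Rightarrow> 'a). approx_identity D le e
       \<and> (\<forall>d\<in>D. \<forall>a. e d * a = a * e d))"

end

theory Submission
  imports Defs
begin

text \<open>From \<open>m\<^sub>\<alpha>\<close> one gets \<open>\<beta>\<^sub>\<alpha>(x) = x \<cdot> m\<^sub>\<alpha>\<close>, and from \<open>\<beta>\<^sub>\<delta>\<close> the adjoints \<open>\<theta>\<^sub>\<delta> = \<beta>\<^sub>\<delta>\<^sup>*\<close>.
  For the two implications back to pseudo-amenability no second dual is needed: by Hahn-Banach, a
  finite system \<open>a\<^sub>i \<cdot> m - m \<cdot> a\<^sub>i \<approx> 0\<close>, \<open>\<pi>(m) a\<^sub>i \<approx> a\<^sub>i\<close> is solvable unless there are functionals with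
  \<open>\<Sum>\<^sub>i (\<phi>\<^sub>i \<cdot> a\<^sub>i - a\<^sub>i \<cdot> \<phi>\<^sub>i + \<pi>\<^sup>*(a\<^sub>i \<cdot> \<psi>\<^sub>i)) = 0\<close> and \<open>\<Sum>\<^sub>i \<langle>a\<^sub>i, \<psi>\<^sub>i\<rangle> \<noteq> 0\<close>. Apply \<open>\<theta>\<^sub>\<delta>\<close> to the
  identity and pair with a member \<open>e\<close> of the approximate identity. The commutator part becomes
  \<open>\<langle>a\<^sub>i e - e a\<^sub>i, \<theta>\<^sub>\<delta>(\<phi>\<^sub>i)\<rangle>\<close>, up to a \<open>w\<^sup>*\<close>-error in case (iii). For central \<open>e\<close> it vanishes, so one
  may let \<open>\<delta>\<close> tend to its limit first and then \<open>e\<close>; in case (iv) there is no error, so one may take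
  the limits in the opposite order. Both ways \<open>\<Sum>\<^sub>i \<langle>a\<^sub>i, \<psi>\<^sub>i\<rangle> = 0\<close>, a contradiction.\<close>

section \<open>The Hahn-Banach theorem\<close>

text \<open>Only an inequality for positive scalars is imposed, which is easy to check for infima;
  applied to \<open>inverse r\<close> it yields equality.\<close>

definition sublinear :: "('a::real_vector \<Rightarrow> real) \<Rightarrow> bool" where
  "sublinear p \<longleftrightarrow> (\<forall>x y. p (x + y) \<le> p x + p y) \<and> (\<forall>r>0. \<forall>x. p (r *\<^sub>R x) \<le> r * p x)"

lemma sublinearI:
  assumes "\<And>x y. p (x + y) \<le> p x + p y" and "\<And>r x. 0 < r \<Longrightarrow> p (r *\<^sub>R x) \<le> r * p x"
  shows "sublinear p"
  using assms by (simp add: sublinear_def)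

lemma sublinear_add: "sublinear p \<Longrightarrow> p (x + y) \<le> p x + p y"
  by (simp add: sublinear_def)

lemma sublinear_scaleR:
  assumes "sublinear p" and "0 \<le> r"
  shows "p (r *\<^sub>R x) = r * p x"
proof -
  have eq: "p (r *\<^sub>R x) = r * p x" if "0 < r" for r x
  proof (rule antisym)
    show "p (r *\<^sub>R x) \<le> r * p x" using assms(1) that by (simp add: sublinear_def)
    have "p (inverse r *\<^sub>R r *\<^sub>R x) \<le> inverse r * p (r *\<^sub>R x)"
      using assms(1) that unfolding sublinear_def by (meson positive_imp_inverse_positive)
    then show "r * p x \<le> p (r *\<^sub>R x)"
      using that by (simp add: field_simps)
  qed
  \<comment> \<open>The instance \<open>eq[of 2 0]\<close> amounts to \<open>p 0 = 2 * p 0\<close>,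
    which settles \<open>r = 0\<close>.\<close>
  show ?thesis
    using eq[of r x] eq[of 2 0] assms(2) by (cases "r = 0") auto
qed

lemma sublinear_zero: "sublinear p \<Longrightarrow> p 0 = 0"
  using sublinear_scaleR[of p 0 0] by simp

lemma sublinear_minus_le: "sublinear p \<Longrightarrow> - p (- x) \<le> p x"
  using sublinear_add[of p x "- x"] sublinear_zero[of p] by simp

text \<open>Hence a minimal sublinear functional is odd, and so linear. The witness is
  \<open>q'(x) = inf {q (x + t v) - t q(v) | t \<ge> 0}\<close>.\<close>

lemma sublinear_shrink:
  fixes v :: "'a::real_vector"
  assumes q: "sublinear q"
  shows "\<exists>q'. sublinear q' \<and> q' \<le> q \<and> q' (- v) \<le> - q v"
proof -
  let ?g = "\<lambda>x t. q (x + t *\<^sub>R v) - t * q v"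
  define q' where "q' x = (INF t\<in>{0..}. ?g x t)" for x
  \<comment> \<open>Subadditivity for \<open>t *\<^sub>R v\<close>, written as the sum of
    \<open>x + t *\<^sub>R v\<close> and \<open>- x\<close>. The bound is uniform in
    \<open>t\<close>, so the infimum is a genuine one.\<close>
  have "- q (- x) \<le> ?g x t" if "0 \<le> t" for x t
    using sublinear_add[OF q, of "x + t *\<^sub>R v" "- x"] sublinear_scaleR[OF q that, of v] by simp
  then have bdd: "bdd_below (?g x ` {0..})" for x
    by (intro bdd_belowI[of _ "- q (- x)"]) auto
  have le: "q' x \<le> ?g x t" if "0 \<le> t" for x t
    unfolding q'_def by (rule cINF_lower[OF bdd]) (use that in simp)
  have ge: "c \<le> q' x" if "\<And>t. 0 \<le> t \<Longrightarrow> c \<le> ?g x t" for c x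
    unfolding q'_def by (rule cINF_greatest) (use that in auto)
  have "sublinear q'"
  proof (rule sublinearI)
    fix x y
    \<comment> \<open>Parameters \<open>s\<close> for \<open>x\<close> and \<open>t\<close> for
      \<open>y\<close> combine to \<open>s + t\<close> for \<open>x + y\<close>; afterwards the
      infimum is taken over \<open>t\<close> and then over \<open>s\<close>.\<close>
    have *: "q' (x + y) \<le> ?g x s + ?g y t" if "0 \<le> s" "0 \<le> t" for s t
    proof -
      have "q' (x + y) \<le> ?g (x + y) (s + t)"
        using that by (intro le) simp
      also have "\<dots> \<le> ?g x s + ?g y t"
        using sublinear_add[OF q, of "x + s *\<^sub>R v" "y + t *\<^sub>R v"] by (simp add: algebra_simps)
      finally show ?thesis .
    qed
    have "q' (x + y) - ?g x s \<le> q' y" if "0 \<le> s" for s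
      by (rule ge) (use *[OF that] in \<open>simp add: algebra_simps\<close>)
    then have "q' (x + y) - q' y \<le> q' x"
      by (intro ge) (simp add: algebra_simps)
    then show "q' (x + y) \<le> q' x + q' y" by simp
  next
    fix r :: real and x
    assume r: "0 < r"
    have "q' (r *\<^sub>R x) / r \<le> q' x"
    proof (rule ge)
      fix t :: real
      assume t: "0 \<le> t"
      have "q' (r *\<^sub>R x) \<le> ?g (r *\<^sub>R x) (r * t)"
        using r t by (intro le) simp
      also have "\<dots> = r * ?g x t"
        using sublinear_scaleR[OF q less_imp_le[OF r], of "x + t *\<^sub>R v"] by (simp add: algebra_simps)
      finally show "q' (r *\<^sub>R x) / r \<le> ?g x t"
        using r by (simp add: field_simps)
    qed
    then show "q' (r *\<^sub>R x) \<le> r * q' x"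
      using r by (simp add: field_simps)
  qed
  moreover have "q' \<le> q"
    using le[of 0] by (auto simp: le_fun_def)
  moreover have "q' (- v) \<le> - q v"
    using le[of 1 "- v"] sublinear_zero[OF q] by simp
  ultimately show ?thesis by blast
qed

text \<open>Supplies the bounds of chains for Zorn's lemma. The infimum is finite since
  \<open>- p (- x)\<close> lies below the value of every member at \<open>x\<close>; subadditivity
  uses the chain, because two members can both be replaced by the smaller one.\<close>

lemma sublinear_chain_INF:
  assumes "C \<noteq> {}" and "\<And>q. q \<in> C \<Longrightarrow> sublinear q \<and> q \<le> p"
    and chain: "\<And>q q'. q \<in> C \<Longrightarrow> q' \<in> C \<Longrightarrow> q \<le> q' \<or> q' \<le> q"
  shows "sublinear (\<lambda>x. INF q\<in>C. q x)" and "q \<in> C \<Longrightarrow> (\<lambda>x. INF q\<in>C. q x) \<le> q"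
proof -
  let ?u = "\<lambda>x. INF q\<in>C. q x"
  have "- p (- x) \<le> q x" if "q \<in> C" for q x
    using sublinear_minus_le[of q x] assms(2)[OF that] le_funD[of q p "- x"] by force
  then have bdd: "bdd_below ((\<lambda>q. q x) ` C)" for x
    by (intro bdd_belowI[of _ "- p (- x)"]) auto
  have le: "?u x \<le> q x" if "q \<in> C" for q x
    by (rule cINF_lower[OF bdd that])
  have ge: "c \<le> ?u x" if "\<And>q. q \<in> C \<Longrightarrow> c \<le> q x" for c x
    by (rule cINF_greatest) (use assms(1) that in auto)
  show "?u \<le> q" if "q \<in> C"
    using le[OF that] by (simp add: le_fun_def)
  show "sublinear ?u"
  proof (rule sublinearI)
    fix x y
    have *: "?u (x + y) \<le> q x + q' y" if "q \<in> C" "q' \<in> C" for q q'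
    proof -
      have "\<exists>w\<in>C. w \<le> q \<and> w \<le> q'"
        using chain[OF that] that by auto
      then obtain w where w: "w \<in> C" "w \<le> q" "w \<le> q'" by blast
      have "?u (x + y) \<le> w x + w y"
        using le[OF w(1), of "x + y"] sublinear_add[of w x y] assms(2)[OF w(1)] by simp
      with le_funD[OF w(2), of x] le_funD[OF w(3), of y] show ?thesis by simp
    qed
    have "?u (x + y) - q x \<le> ?u y" if "q \<in> C" for q
      by (rule ge) (use *[OF that] in \<open>simp add: algebra_simps\<close>)
    then have "?u (x + y) - ?u y \<le> ?u x"
      by (intro ge) (simp add: algebra_simps)
    then show "?u (x + y) \<le> ?u x + ?u y" by simp
  next
    fix r :: real and x
    assume r: "0 < r"
    have "?u (r *\<^sub>R x) / r \<le> ?u x"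
    proof (rule ge)
      fix q
      assume "q \<in> C"
      then show "?u (r *\<^sub>R x) / r \<le> q x"
        using le[of q "r *\<^sub>R x"] sublinear_scaleR[of q r x] assms(2)[of q] r
        by (simp add: field_simps)
    qed
    then show "?u (r *\<^sub>R x) \<le> r * ?u x"
      using r by (simp add: field_simps)
  qed
qed

text \<open>A minimal sublinear functional \<open>f\<close> below \<open>p'\<close> is linear,
  because \<open>sublinear_shrink\<close> cannot lower it. Starting from \<open>p'\<close> rather
  than \<open>p\<close> forces \<open>f (- v) \<le> - p v\<close>, hence equality at
  \<open>v\<close>.\<close>

theorem hahn_banach_sublinear:
  assumes p: "sublinear p"
  obtains f where "linear f" and "\<And>x. f x \<le> p x" and "f v = p v"
proof -
  obtain p' where p': "sublinear p'" "p' \<le> p" "p' (- v) \<le> - p v"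
    using sublinear_shrink[OF p] by blast
  let ?A = "{q. sublinear q \<and> q \<le> p'}"
  \<comment> \<open>Zorn's lemma is applied to the reversed order, so its maximal element is a
    minimal functional.\<close>
  have "\<exists>f\<in>?A. \<forall>q\<in>?A. f \<ge> q \<longrightarrow> q = f"
  proof (rule predicate_Zorn)
    show "partial_order_on ?A (relation_of (\<ge>) ?A)"
      by (rule partial_order_on_relation_ofI) auto
    fix C
    assume C: "C \<in> Chains (relation_of (\<ge>) ?A)"
    then have sub: "sublinear q \<and> q \<le> p'" if "q \<in> C" for q
      using that by (auto simp: Chains_def relation_of_def)
    have chain: "q \<le> q' \<or> q' \<le> q" if "q \<in> C" "q' \<in> C" for q q'
      using C that by (auto simp: Chains_def relation_of_def)
    show "\<exists>u\<in>?A. \<forall>q\<in>C. q \<ge> u"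
    proof (cases "C = {}")
      case True
      with p'(1) show ?thesis by auto
    next
      case False
      then obtain q where "q \<in> C" by blast
      have inf: "sublinear (\<lambda>x. INF q\<in>C. q x)" "\<And>q. q \<in> C \<Longrightarrow> (\<lambda>x. INF q\<in>C. q x) \<le> q"
        using sublinear_chain_INF[of C p'] False sub chain by auto
      have "(\<lambda>x. INF q\<in>C. q x) \<le> p'"
        using order_trans[OF inf(2)[OF \<open>q \<in> C\<close>]] sub[OF \<open>q \<in> C\<close>] by blast
      with inf show ?thesis by (intro bexI[of _ "\<lambda>x. INF q\<in>C. q x"]) auto
    qed
  qed
  then obtain f where f: "sublinear f" "f \<le> p'" and "\<forall>q\<in>?A. q \<le> f \<longrightarrow> q = f"
    by blast
  then have min: "q = f" if "sublinear q" "q \<le> f" for q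
    using that order_trans[OF that(2) f(2)] by blast
  have odd: "f (- x) = - f x" for x
  proof -
    obtain q where "sublinear q" "q \<le> f" "q (- x) \<le> - f x"
      using sublinear_shrink[OF f(1)] by blast
    with min[of q] sublinear_minus_le[OF f(1), of x] show ?thesis by simp
  qed
  have "linear f"
  proof (rule linearI)
    \<comment> \<open>Oddness turns subadditivity at \<open>- x\<close> and \<open>- y\<close> into
      superadditivity at \<open>x\<close> and \<open>y\<close>.\<close>
    show "f (x + y) = f x + f y" for x y
      using sublinear_add[OF f(1), of x y] sublinear_add[OF f(1), of "- x" "- y"]
        odd[of "x + y"] by (simp add: odd)
    show "f (r *\<^sub>R x) = r *\<^sub>R f x" for r x
      using sublinear_scaleR[OF f(1), of r x] sublinear_scaleR[OF f(1), of "- r" x] odd[of "r *\<^sub>R x"]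
      by (cases "0 \<le> r") auto
  qed
  moreover have "f x \<le> p x" for x
    using le_funD[OF f(2)] le_funD[OF p'(2)] order_trans by blast
  moreover have "f v = p v"
    using le_funD[OF f(2), of "- v"] p'(3) odd[of v] \<open>f v \<le> p v\<close> by simp
  ultimately show ?thesis by (rule that)
qed

section \<open>Separation from a subspace and finite linear systems\<close>

text \<open>The distance to the range of \<open>T\<close> is sublinear. A linear functional below it
  that agrees with it at \<open>v\<close> is bounded by the norm, vanishes on the range, and is at
  least \<open>d\<close> at \<open>v\<close>.\<close>

lemma separating_functional:
  fixes T :: "'m::real_vector \<Rightarrow> 'y::real_normed_vector"
  assumes T: "linear T" and "0 < d" and dist: "\<And>m. d \<le> norm (v - T m)"
  obtains f where "bounded_linear f" and "\<And>m. f (T m) = 0" and "f v \<noteq> (0 :: real)"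
proof -
  define p where "p y = (INF m. norm (y - T m))" for y
  have bdd: "bdd_below (range (\<lambda>m. norm (y - T m)))" for y
    by (rule bdd_belowI[of _ 0]) auto
  have le: "p y \<le> norm (y - T m)" for y m
    unfolding p_def by (rule cINF_lower[OF bdd]) simp
  have ge: "c \<le> p y" if "\<And>m. c \<le> norm (y - T m)" for c y
    unfolding p_def by (rule cINF_greatest) (use that in auto)
  have "sublinear p"
  proof (rule sublinearI)
    fix x y
    have *: "p (x + y) \<le> norm (x - T m) + norm (y - T n)" for m n
    proof -
      have "x + y - T (m + n) = (x - T m) + (y - T n)"
        by (simp add: linear_add[OF T])
      then show ?thesis
        using le[of "x + y" "m + n"] norm_triangle_ineq[of "x - T m" "y - T n"] by (simp only:)
    qed
    have "p (x + y) - norm (x - T m) \<le> p y" for m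
      by (rule ge) (use *[of m] in \<open>simp add: algebra_simps\<close>)
    then have "p (x + y) - p y \<le> p x"
      by (intro ge) (simp add: algebra_simps)
    then show "p (x + y) \<le> p x + p y" by simp
  next
    fix r :: real and x
    assume r: "0 < r"
    have "p (r *\<^sub>R x) / r \<le> p x"
    proof (rule ge)
      fix m
      have "r *\<^sub>R x - T (r *\<^sub>R m) = r *\<^sub>R (x - T m)"
        by (simp add: linear_scale[OF T] scaleR_diff_right)
      then have "p (r *\<^sub>R x) \<le> norm (r *\<^sub>R (x - T m))"
        using le[of "r *\<^sub>R x" "r *\<^sub>R m"] by (simp only:)
      then show "p (r *\<^sub>R x) / r \<le> norm (x - T m)"
        using r by (simp add: divide_le_eq mult.commute)
    qed
    then show "p (r *\<^sub>R x) \<le> r * p x"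
      using r by (simp add: field_simps)
  qed
  then obtain f where f: "linear f" "\<And>y. f y \<le> p y" "f v = p v"
    by (rule hahn_banach_sublinear) blast
  have "f y \<le> norm y" for y
    using f(2)[of y] le[of y 0] by (simp add: linear_0[OF T])
  from this this[of "- y" for y] have "norm (f y) \<le> norm y * 1" for y
    by (simp add: abs_le_iff linear_neg[OF f(1)])
  then have "bounded_linear f"
    using f(1) by (intro bounded_linear_intro[where K = 1]) (simp_all add: linear_add linear_scale)
  moreover have "f (T m) = 0" for m
  proof -
    \<comment> \<open>On the range the distance is at most zero, and the range is closed under
      negation.\<close>
    have "f (T n) \<le> 0" for n
      using f(2)[of "T n"] le[of "T n" n] by simp
    from this[of m] this[of "- m"] show ?thesis
      by (simp add: linear_neg[OF T] linear_neg[OF f(1)])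
  qed
  moreover have "f v \<noteq> 0"
    using ge[OF dist] f(3) \<open>0 < d\<close> by simp
  ultimately show ?thesis by (rule that)
qed

text \<open>The finite power of \<open>'y\<close> needed here is embedded in the bounded functions on the discrete
  space \<^typ>\<open>nat\<close>, which avoids an index type depending on \<open>n\<close>.\<close>

lemma finite_system_approx:
  fixes S :: "nat \<Rightarrow> 'm::real_vector \<Rightarrow> 'y::real_normed_vector"
  assumes S: "\<And>i. linear (S i)" and "0 < e"
    and dual: "\<And>g. (\<And>i. bounded_linear (g i)) \<Longrightarrow> (\<And>m. (\<Sum>i<n. g i (S i m)) = 0)
      \<Longrightarrow> (\<Sum>i<n. g i (v i)) = (0 :: real)"
  shows "\<exists>m. \<forall>i<n. norm (v i - S i m) < e"
proof (rule ccontr)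
  assume far: "\<not> ?thesis"
  define J :: "nat \<Rightarrow> 'y \<Rightarrow> (nat \<Rightarrow>\<^sub>C 'y)" where "J i y = Bcontfun (\<lambda>j. if j = i then y else 0)" for i y
  have J: "apply_bcontfun (J i y) j = (if j = i then y else 0)" for i j y
    unfolding J_def
    by (subst Bcontfun_inverse) (auto intro!: bcontfun_normI[where b = "norm y"])
  have J_lin: "bounded_linear (J i)" for i
  proof (rule bounded_linear_intro[where K = 1])
    show "norm (J i y) \<le> norm y * 1" for y
      by (rule norm_bound) (simp add: J)
  qed (auto intro!: bcontfun_eqI simp: J)
  have J_sum: "apply_bcontfun (\<Sum>i<n. J i (w i)) j = (if j < n then w j else 0)" for w j
  proof -
    have "apply_bcontfun (\<Sum>i\<in>I. J i (w i)) j = (\<Sum>i\<in>I. apply_bcontfun (J i (w i)) j)" if "finite I" for I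
      using that by induction auto
    then show ?thesis by (simp add: J)
  qed
  define T where "T m = (\<Sum>i<n. J i (S i m))" for m
  define V where "V = (\<Sum>i<n. J i (v i))"
  note Jl = bounded_linear.linear[OF J_lin]
  have "linear T"
    by (rule linearI)
      (simp_all add: T_def linear_add[OF S] linear_scale[OF S] linear_add[OF Jl] linear_scale[OF Jl]
        sum.distrib scaleR_sum_right)
  moreover have "e \<le> norm (V - T m)" for m
  proof -
    \<comment> \<open>By \<open>far\<close> some coordinate has error at least \<open>e\<close>, and
      the supremum norm dominates each coordinate.\<close>
    obtain i where i: "i < n" "e \<le> norm (v i - S i m)"
      using far by (meson not_less)
    with norm_bounded[of "V - T m" i] show ?thesis
      by (simp add: V_def T_def J_sum)
  qed
  ultimately obtain f where f: "bounded_linear f" "\<And>m. f (T m) = 0" "f V \<noteq> (0 :: real)"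
    using separating_functional[OF _ \<open>0 < e\<close>] by metis
  have f_sum: "f (\<Sum>i<n. J i (w i)) = (\<Sum>i<n. f (J i (w i)))" for w
    by (rule linear_sum) (rule bounded_linear.linear[OF f(1)])
  \<comment> \<open>The coordinates of the separating functional annihilate the system, so
    \<open>dual\<close> contradicts \<open>f V \<noteq> 0\<close>.\<close>
  have "(\<Sum>i<n. f (J i (v i))) = 0"
  proof (rule dual)
    show "bounded_linear (\<lambda>y. f (J i y))" for i
      by (rule bounded_linear_compose[OF f(1) J_lin])
    show "(\<Sum>i<n. f (J i (S i m))) = 0" for m
      using f(2)[of m] by (simp only: T_def f_sum)
  qed
  with f(3) show False by (simp add: V_def f_sum)
qed

section \<open>A duality criterion for pseudo-amenability\<close>

lemma net_filter_neq_bot: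
  assumes "directed_index D le"
  shows "net_filter D le \<noteq> bot"
  using assms unfolding trivial_limit_def eventually_net_filter[OF assms] directed_index_def by blast

lemma eventually_net_filter_mem:
  assumes "directed_index D le"
  shows "eventually (\<lambda>d. d \<in> D) (net_filter D le)"
  using assms unfolding eventually_net_filter[OF assms] directed_index_def by blast

text \<open>Limits of functions of the values of a net depend only on the image filter; this carries
  convergence across \<open>net_reindex\<close>.\<close>

lemma tendsto_filtermap_eq:
  assumes "filtermap g G = filtermap f F"
  shows "((\<lambda>d. h (g d)) \<longlongrightarrow> l) G \<longleftrightarrow> ((\<lambda>d. h (f d)) \<longlongrightarrow> l) F"
  using filterlim_filtermap[of h "nhds l" g G] filterlim_filtermap[of h "nhds l" f F] assms by simp

text \<open>An index pairs the set of elements to be controlled with a number \<open>n\<close> that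
  encodes the tolerance \<open>inverse (real (Suc n))\<close>. Finiteness is put into the index set,
  not into the order.\<close>

definition approx_le :: "'a set \<times> nat \<Rightarrow> 'a set \<times> nat \<Rightarrow> bool" where
  "approx_le p q \<longleftrightarrow> fst p \<subseteq> fst q \<and> snd p \<le> snd q"

lemma directed_index_approx: "directed_index {p. finite (fst p)} approx_le"
  unfolding directed_index_def
proof (intro conjI ballI)
  fix p q :: "'a set \<times> nat"
  assume "p \<in> {p. finite (fst p)}" "q \<in> {p. finite (fst p)}"
  then show "\<exists>r\<in>{p. finite (fst p)}. approx_le p r \<and> approx_le q r"
    by (intro bexI[of _ "(fst p \<union> fst q, max (snd p) (snd q))"]) (auto simp: approx_le_def)
qed (auto simp: approx_le_def)

text \<open>Every index past \<open>({a}, n)\<close> contains \<open>a\<close> and has tolerance at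
  most \<open>inverse (real (Suc n))\<close>.\<close>

lemma tendsto_approx:
  fixes h :: "'a set \<times> nat \<Rightarrow> 'b::real_normed_vector"
  assumes h: "\<And>p. finite (fst p) \<Longrightarrow> a \<in> fst p \<Longrightarrow> norm (h p - l) < inverse (real (Suc (snd p)))"
  shows "(h \<longlongrightarrow> l) (net_filter {p. finite (fst p)} approx_le)"
proof (rule tendstoI)
  fix e :: real
  assume "0 < e"
  then obtain n where n: "inverse (real (Suc n)) < e"
    using reals_Archimedean by blast
  show "\<forall>\<^sub>F p in net_filter {p. finite (fst p)} approx_le. dist (h p) l < e"
    unfolding eventually_net_filter[OF directed_index_approx]
  proof (intro bexI[of _ "({a}, n)"] ballI impI)
    fix p :: "'a set \<times> nat"
    assume "p \<in> {p. finite (fst p)}" and "approx_le ({a}, n) p"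
    then have p: "finite (fst p)" "a \<in> fst p" "n \<le> snd p"
      by (auto simp: approx_le_def)
    have "inverse (real (Suc (snd p))) \<le> inverse (real (Suc n))"
      using p(3) by (intro le_imp_inverse_le) auto
    with h[OF p(1,2)] n show "dist (h p) l < e"
      unfolding dist_norm by linarith
  qed simp
qed

section \<open>Module actions, pairings and complex functionals\<close>

lemma product_map_acts:
  shows "product_map (ptensor_lact a m) = a * product_map m"
    and "product_map (ptensor_ract m a) = product_map m * a"
proof -
  have bl: "bounded_linear (\<lambda>m. product_map (ptensor_lact a m))"
    "bounded_linear (\<lambda>m. product_map (ptensor_ract m a))"
    "bounded_linear (product_map :: ('a, 'a) ptensor \<Rightarrow> 'a)"
    using bounded_clinear_compose[OF bounded_clinear_product_map bounded_clinear_ptensor_lact]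
      bounded_clinear_compose[OF bounded_clinear_product_map bounded_clinear_ptensor_ract]
      bounded_clinear_product_map
    by (auto simp: bounded_clinear_def)
  show "product_map (ptensor_lact a m) = a * product_map m"
    by (rule bounded_linear_ptensor_eqI[OF bl(1)
          bounded_linear_compose[OF bounded_linear_mult_right bl(3)], THEN fun_cong])
      (simp add: mult.assoc)
  show "product_map (ptensor_ract m a) = product_map m * a"
    by (rule bounded_linear_ptensor_eqI[OF bl(2)
          bounded_linear_compose[OF bounded_linear_mult_left bl(3)], THEN fun_cong])
      (simp add: mult.assoc)
qed

lemma pairing_bounded_linear:
  "bounded_linear (\<lambda>x. \<langle>x, \<phi>\<rangle>)" "bounded_linear (\<lambda>\<phi>. \<langle>x, \<phi>\<rangle>)"
  using bounded_cbilinear_clinear[OF bounded_cbilinear_pairing] by (auto simp: bounded_clinear_def)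

lemmas pairing_linear_simps =
  bounded_linear.linear[OF pairing_bounded_linear(1), THEN linear_diff]
  bounded_linear.linear[OF pairing_bounded_linear(2), THEN linear_diff]
  bounded_linear.linear[OF pairing_bounded_linear(1), THEN linear_0]
  bounded_linear.linear[OF pairing_bounded_linear(2), THEN linear_0]
  bounded_linear.linear[OF pairing_bounded_linear(2), THEN linear_sum]
  pairing_simps(1,2)

text \<open>Allows a merely real-linear functional to be evaluated at complex multiples.\<close>

lemma scaleC_complex_decompose: "c *\<^sub>C x = Re c *\<^sub>R x + Im c *\<^sub>R \<i> *\<^sub>C x"
proof -
  have "(of_real (Re c) + of_real (Im c) * \<i>) *\<^sub>C x = Re c *\<^sub>R x + Im c *\<^sub>R \<i> *\<^sub>C x"
    by (simp add: scaleC_add_left scaleC_of_real flip: scaleC_scaleC)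
  moreover have "of_real (Re c) + of_real (Im c) * \<i> = c"
    by (simp add: complex_eq_iff)
  ultimately show ?thesis by simp
qed

text \<open>The Hahn-Banach functionals obtained above are real. As the real part of a complex
  functional, \<open>g\<close> determines the imaginary part: complex homogeneity at
  \<open>\<i>\<close> forces \<open>- g (\<i> *\<^sub>C x)\<close>.\<close>

lemma cdual_of_real_functional:
  fixes g :: "'x::complex_normed_vector \<Rightarrow> real"
  assumes g: "bounded_linear g"
  obtains \<phi> :: "'x cdual" where "\<And>x. \<langle>x, \<phi>\<rangle> = Complex (g x) (- g (\<i> *\<^sub>C x))"
proof -
  let ?F = "\<lambda>x. Complex (g x) (- g (\<i> *\<^sub>C x))"
  note gl = linear_add[OF bounded_linear.linear[OF g]] linear_diff[OF bounded_linear.linear[OF g]]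
    linear_scale[OF bounded_linear.linear[OF g]]
  have "bounded_linear (\<lambda>x. of_real (g x) + \<i> * of_real (- g (\<i> *\<^sub>C x)))"
    by (intro bounded_linear_add bounded_linear_compose[OF bounded_linear_mult_right]
        bounded_linear_compose[OF bounded_linear_of_real] bounded_linear_minus
        bounded_linear_compose[OF g] bounded_linear_scaleC bounded_linear_ident)
  then have bl: "bounded_linear ?F"
    by (simp add: Complex_eq)
  have "?F (c *\<^sub>C x) = c * ?F x" for c x
  proof -
    have "g (c *\<^sub>C x) = Re c * g x + Im c * g (\<i> *\<^sub>C x)"
      by (subst scaleC_complex_decompose) (simp add: gl)
    moreover have "g (\<i> *\<^sub>C c *\<^sub>C x) = Re c * g (\<i> *\<^sub>C x) - Im c * g x"
      unfolding scaleC_scaleC by (subst scaleC_complex_decompose) (simp add: gl)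
    ultimately show ?thesis by (simp add: complex_eq_iff)
  qed
  then have "\<langle>x, Abs_cdual (Blinfun ?F)\<rangle> = ?F x" for x
    unfolding pairing.rep_eq
    by (subst Abs_cdual_inverse) (simp_all add: bounded_linear_Blinfun_apply[OF bl])
  then show ?thesis by (rule that)
qed

lemmas bounded_linear_ptensor_acts =
  bounded_clinear_ptensor_lact[unfolded bounded_clinear_def, THEN conjunct1]
  bounded_clinear_ptensor_ract[unfolded bounded_clinear_def, THEN conjunct1]
  bounded_clinear_product_map[unfolded bounded_clinear_def, THEN conjunct1]

lemma ptensor_scaleC:
  "ptensor_lact a (c *\<^sub>C m) = c *\<^sub>C ptensor_lact a m"
  "ptensor_ract (c *\<^sub>C m) a = c *\<^sub>C ptensor_ract m a"
  "product_map (c *\<^sub>C m) = c *\<^sub>C product_map m"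
  using bounded_clinear_ptensor_lact[of a] bounded_clinear_ptensor_ract[of a]
    bounded_clinear_product_map[where 'a = 'a]
  unfolding bounded_clinear_def by blast+

section \<open>From finite systems to pseudo-amenability\<close>

text \<open>Choosing \<open>m\<close> for each finite set and tolerance gives a net;
  \<open>net_reindex\<close> moves it to the index type used in \<open>pseudo_amenable\<close>
  without changing its image filter.\<close>

lemma pseudo_amenableI_finite:
  assumes "\<And>(F :: 'a::complex_banach_algebra set) e. finite F \<Longrightarrow> 0 < e \<Longrightarrow>
    \<exists>m. \<forall>a\<in>F. norm (ptensor_lact a m - ptensor_ract m a) < e \<and> norm (product_map m * a - a) < e"
  shows "pseudo_amenable TYPE('a)"
proof -
  let ?D = "{p :: 'a set \<times> nat. finite (fst p)}"
  let ?r = "\<lambda>p :: 'a set \<times> nat. inverse (real (Suc (snd p)))"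
  have "\<exists>m. \<forall>a\<in>fst p. norm (ptensor_lact a m - ptensor_ract m a) < ?r p
      \<and> norm (product_map m * a - a) < ?r p" if "finite (fst p)" for p
    using that by (rule assms) simp
  then obtain m where m: "\<And>p a. finite (fst p) \<Longrightarrow> a \<in> fst p \<Longrightarrow>
      norm (ptensor_lact a (m p) - ptensor_ract (m p) a) < ?r p \<and> norm (product_map (m p) * a - a) < ?r p"
    by metis
  obtain D' :: "('a, 'a) ptensor net_index set" and le' m' where D': "directed_index D' le'"
    and eq: "filtermap m' (net_filter D' le') = filtermap m (net_filter ?D approx_le)"
    using net_reindex[OF directed_index_approx, of m] by blast
  have "((\<lambda>d. ptensor_lact a (m' d) - ptensor_ract (m' d) a) \<longlongrightarrow> 0) (net_filter D' le')" for a
    unfolding tendsto_filtermap_eq[OF eq, where h = "\<lambda>m. ptensor_lact a m - ptensor_ract m a"]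
    by (rule tendsto_approx[where a = a]) (use m in simp)
  moreover have "((\<lambda>d. product_map (m' d) * a) \<longlongrightarrow> a) (net_filter D' le')" for a
    unfolding tendsto_filtermap_eq[OF eq, where h = "\<lambda>m. product_map m * a"]
    by (rule tendsto_approx[where a = a]) (use m in simp)
  ultimately show ?thesis
    unfolding pseudo_amenable_def using D' by blast
qed

lemma pairing_ptensor_acts:
  "\<langle>m, dual_lact ptensor_ract a \<phi>\<rangle> = \<langle>ptensor_ract m a, \<phi>\<rangle>"
  "\<langle>m, dual_ract ptensor_lact \<phi> a\<rangle> = \<langle>ptensor_lact a m, \<phi>\<rangle>"
  by (rule pairing_dual_acts[OF banach_bimodule_ptensor])+

lemma pairing_self_acts:
  fixes a x :: "'a::complex_banach_algebra"
  shows "\<langle>x, dual_lact (*) a \<psi>\<rangle> = \<langle>x * a, \<psi>\<rangle>" "\<langle>x, dual_ract (*) \<psi> a\<rangle> = \<langle>a * x, \<psi>\<rangle>"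
  by (rule pairing_dual_acts[OF banach_bimodule_self])+

text \<open>Pairing the sum in \<open>dual\<close> with \<open>m\<close> evaluates
  \<open>\<phi> i\<close> at the commutator of \<open>a i\<close> and \<open>m\<close>, and
  \<open>\<psi> i\<close> at \<open>product_map m * a i\<close>. So \<open>dual\<close> says that
  functionals annihilating the finite system also annihilate its target, which is what
  \<open>finite_system_approx\<close> asks for.\<close>

lemma pseudo_amenableI_dual:
  assumes dual: "\<And>n (a :: nat \<Rightarrow> 'a::complex_banach_algebra) \<phi> \<psi>.
    (\<Sum>i<n. dual_ract ptensor_lact (\<phi> i) (a i) - dual_lact ptensor_ract (a i) (\<phi> i)
        + dual_map product_map (dual_lact (*) (a i) (\<psi> i))) = 0
    \<Longrightarrow> (\<Sum>i<n. \<langle>a i, \<psi> i\<rangle>) = 0"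
  shows "pseudo_amenable TYPE('a)"
proof (rule pseudo_amenableI_finite)
  fix F :: "'a set" and e :: real
  assume "finite F" and "0 < e"
  from ex_bij_betw_nat_finite[OF \<open>finite F\<close>] obtain a n where F: "F = a ` {..<n :: nat}"
    by (metis atLeast0LessThan bij_betw_imp_surj_on)
  \<comment> \<open>The target of \<open>S i\<close> is \<open>(0, a i)\<close>: approximate
    commutation in the first coordinate, an approximate unit in the second.\<close>
  define S where "S i m = (ptensor_lact (a i) m - ptensor_ract m (a i), product_map m * a i)" for i m
  have S: "bounded_linear (S i)" for i
    unfolding S_def
    by (intro bounded_linear_Pair bounded_linear_sub bounded_linear_ptensor_acts
        bounded_linear_compose[OF bounded_linear_mult_left])
  have S_scale: "S i (\<i> *\<^sub>C m) = (\<i> *\<^sub>C fst (S i m), \<i> *\<^sub>C snd (S i m))" for i m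
    by (simp add: S_def ptensor_scaleC scaleC_diff_right mult_scaleC_left)
  have "\<exists>m. \<forall>i<n. norm ((0, a i) - S i m) < e"
  proof (rule finite_system_approx[OF bounded_linear.linear[OF S] \<open>0 < e\<close>])
    fix g :: "nat \<Rightarrow> ('a, 'a) ptensor \<times> 'a \<Rightarrow> real"
    assume g: "\<And>i. bounded_linear (g i)" and g0: "\<And>m. (\<Sum>i<n. g i (S i m)) = 0"
    have "\<exists>\<phi>. \<forall>t. \<langle>t, \<phi>\<rangle> = Complex (g i (t, 0)) (- g i (\<i> *\<^sub>C t, 0))" for i
      by (rule cdual_of_real_functional[OF bounded_linear_compose[OF g bounded_linear_Pair[OF
              bounded_linear_ident bounded_linear_zero]]]) auto
    then obtain \<phi> where \<phi>: "\<And>i t. \<langle>t, \<phi> i\<rangle> = Complex (g i (t, 0)) (- g i (\<i> *\<^sub>C t, 0))"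
      by metis
    have "\<exists>\<psi>. \<forall>x. \<langle>x, \<psi>\<rangle> = Complex (g i (0, x)) (- g i (0, \<i> *\<^sub>C x))" for i
      by (rule cdual_of_real_functional[OF bounded_linear_compose[OF g bounded_linear_Pair[OF
              bounded_linear_zero bounded_linear_ident]]]) auto
    then obtain \<psi> where \<psi>: "\<And>i x. \<langle>x, \<psi> i\<rangle> = Complex (g i (0, x)) (- g i (0, \<i> *\<^sub>C x))"
      by metis
    have g_split: "g i (t, 0) + g i (0, x) = g i (t, x)" for i t x
      using linear_add[OF bounded_linear.linear[OF g], of i "(t, 0)" "(0, x)"] by simp
    \<comment> \<open>The imaginary part is minus the real functional at
      \<open>\<i> *\<^sub>C m\<close>, so \<open>g0\<close>, holding for all \<open>m\<close>, makes
      both parts of the sum vanish.\<close>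
    have pair: "\<langle>fst (S i m), \<phi> i\<rangle> + \<langle>snd (S i m), \<psi> i\<rangle>
        = Complex (g i (S i m)) (- g i (S i (\<i> *\<^sub>C m)))" for i m
      using g_split[of i "fst (S i m)" "snd (S i m)"]
        g_split[of i "\<i> *\<^sub>C fst (S i m)" "\<i> *\<^sub>C snd (S i m)"]
      by (simp add: \<phi> \<psi> S_scale complex_eq_iff)
    have sum_Complex: "(\<Sum>i\<in>I. Complex (p i) (q i)) = Complex (\<Sum>i\<in>I. p i) (\<Sum>i\<in>I. q i)"
      for p q and I :: "nat set"
      by (simp add: complex_eq_iff)
    have "(\<Sum>i<n. dual_ract ptensor_lact (\<phi> i) (a i) - dual_lact ptensor_ract (a i) (\<phi> i)
        + dual_map product_map (dual_lact (*) (a i) (\<psi> i))) = 0"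
    proof (rule cdual_eqI)
      fix m
      have "\<langle>m, \<Sum>i<n. dual_ract ptensor_lact (\<phi> i) (a i) - dual_lact ptensor_ract (a i) (\<phi> i)
          + dual_map product_map (dual_lact (*) (a i) (\<psi> i))\<rangle>
        = (\<Sum>i<n. \<langle>fst (S i m), \<phi> i\<rangle> + \<langle>snd (S i m), \<psi> i\<rangle>)"
        by (simp add: pairing_linear_simps pairing_ptensor_acts pairing_self_acts
            pairing_dual_map[OF bounded_clinear_product_map] S_def)
      also have "\<dots> = \<langle>m, 0\<rangle>"
        by (simp add: pair sum_Complex sum_negf g0 pairing_linear_simps zero_complex.code)
      finally show "\<langle>m, \<Sum>i<n. dual_ract ptensor_lact (\<phi> i) (a i) - dual_lact ptensor_ract (a i) (\<phi> i)
          + dual_map product_map (dual_lact (*) (a i) (\<psi> i))\<rangle> = \<langle>m, 0\<rangle>" .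
    qed
    \<comment> \<open>The real part of \<open>\<langle>a i, \<psi> i\<rangle>\<close> is
      \<open>g i (0, a i)\<close>.\<close>
    from dual[OF this] show "(\<Sum>i<n. g i (0, a i)) = 0"
      by (simp add: \<psi> sum_Complex complex_eq_iff)
  qed
  then obtain m where m: "\<And>i. i < n \<Longrightarrow> norm ((0, a i) - S i m) < e" by blast
  have "norm (ptensor_lact (a i) m - ptensor_ract m (a i)) < e \<and> norm (product_map m * a i - a i) < e"
    if "i < n" for i
  proof -
    have "norm (fst z) \<le> norm z" "norm (snd z) \<le> norm z" for z :: "('a, 'a) ptensor \<times> 'a"
      using norm_fst_le[of "fst z" "snd z"] norm_snd_le[of "snd z" "fst z"] by simp_all
    from le_less_trans[OF this(1) m[OF that]] le_less_trans[OF this(2) m[OF that]]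
    show ?thesis
      by (simp add: S_def norm_minus_commute)
  qed
  then show "\<exists>m. \<forall>a\<in>F. norm (ptensor_lact a m - ptensor_ract m a) < e \<and> norm (product_map m * a - a) < e"
    by (auto simp: F)
qed

section \<open>The implications\<close>

text \<open>Frees the index type fixed in \<open>has_approx_splitting\<close>: after
  \<open>net_reindex\<close>, inclusion of the values preserves bounded linearity and equality of
  the image filters preserves the limits.\<close>

lemma has_approx_splittingI:
  fixes \<beta> :: "'i \<Rightarrow> 'a::complex_banach_algebra \<Rightarrow> ('a, 'a) ptensor"
  assumes \<beta>: "approx_bimodule_morphism (*) (*) ptensor_lact ptensor_ract D le \<beta>"
    and lim: "\<And>a. ((\<lambda>d. norm (product_map (\<beta> d a) - a)) \<longlongrightarrow> 0) (net_filter D le)"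
  shows "has_approx_splitting TYPE('a)"
proof -
  have "directed_index D le"
    using \<beta> by (simp add: approx_bimodule_morphism_def)
  from net_reindex[OF this, of \<beta>]
  obtain D' :: "('a \<Rightarrow> ('a, 'a) ptensor) net_index set" and le' \<beta>'
    where D': "directed_index D' le'" "\<beta>' ` D' \<subseteq> \<beta> ` D"
      and eq: "filtermap \<beta>' (net_filter D' le') = filtermap \<beta> (net_filter D le)"
    by blast
  have "bounded_clinear (\<beta>' d)" if "d \<in> D'" for d
  proof -
    have "\<beta>' d \<in> \<beta> ` D"
      by (rule subsetD[OF D'(2) imageI[OF that]])
    then obtain c where "\<beta>' d = \<beta> c" "c \<in> D"
      by (rule imageE)
    then show ?thesis
      using \<beta> by (simp add: approx_bimodule_morphism_def)
  qed
  moreover have "((\<lambda>d. norm (\<beta>' d (a * x) - ptensor_lact a (\<beta>' d x))) \<longlongrightarrow> 0) (net_filter D' le')"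
    and "((\<lambda>d. norm (\<beta>' d (x * a) - ptensor_ract (\<beta>' d x) a)) \<longlongrightarrow> 0) (net_filter D' le')" for a x
    using \<beta> unfolding approx_bimodule_morphism_def
      tendsto_filtermap_eq[OF eq, where h = "\<lambda>T. norm (T (a * x) - ptensor_lact a (T x))"]
      tendsto_filtermap_eq[OF eq, where h = "\<lambda>T. norm (T (x * a) - ptensor_ract (T x) a)"]
    by blast+
  ultimately have "approx_bimodule_morphism (*) (*) ptensor_lact ptensor_ract D' le' \<beta>'"
    using D'(1) unfolding approx_bimodule_morphism_def by blast
  moreover have "((\<lambda>d. norm (product_map (\<beta>' d a) - a)) \<longlongrightarrow> 0) (net_filter D' le')" for a
    using lim tendsto_filtermap_eq[OF eq, where h = "\<lambda>T. norm (product_map (T a) - a)"] by simp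
  ultimately show ?thesis
    unfolding has_approx_splitting_def by blast
qed

text \<open>The argument of \<open>has_approx_splittingI\<close> applies, since the weak-star limits
  are again limits of functions of the value \<open>\<theta> d\<close>.\<close>

lemma has_wstar_approx_splittingI:
  fixes \<theta> :: "'i \<Rightarrow> ('a::complex_banach_algebra, 'a) ptensor cdual \<Rightarrow> 'a cdual"
  assumes \<theta>: "wstar_approx_bimodule_morphism (dual_lact ptensor_ract) (dual_ract ptensor_lact) (*) (*) D le \<theta>"
    and lim: "wstar_ot_tendsto (\<lambda>d. \<theta> d \<circ> dual_map product_map) id (net_filter D le)"
  shows "has_wstar_approx_splitting TYPE('a)"
proof -
  have "directed_index D le"
    using \<theta> by (simp add: wstar_approx_bimodule_morphism_def)
  from net_reindex[OF this, of \<theta>]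
  obtain D' :: "(('a, 'a) ptensor cdual \<Rightarrow> 'a cdual) net_index set" and le' \<theta>'
    where D': "directed_index D' le'" "\<theta>' ` D' \<subseteq> \<theta> ` D"
      and eq: "filtermap \<theta>' (net_filter D' le') = filtermap \<theta> (net_filter D le)"
    by blast
  have "bounded_clinear (\<theta>' d)" if "d \<in> D'" for d
  proof -
    have "\<theta>' d \<in> \<theta> ` D"
      by (rule subsetD[OF D'(2) imageI[OF that]])
    then obtain c where "\<theta>' d = \<theta> c" "c \<in> D"
      by (rule imageE)
    then show ?thesis
      using \<theta> by (simp add: wstar_approx_bimodule_morphism_def)
  qed
  moreover have "((\<lambda>d. \<langle>f, \<theta>' d (dual_lact ptensor_ract a x) - dual_lact (*) a (\<theta>' d x)\<rangle>) \<longlongrightarrow> 0) (net_filter D' le')"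
    and "((\<lambda>d. \<langle>f, \<theta>' d (dual_ract ptensor_lact x a) - dual_ract (*) (\<theta>' d x) a\<rangle>) \<longlongrightarrow> 0) (net_filter D' le')"
    for a x f
    using \<theta> unfolding wstar_approx_bimodule_morphism_def
      tendsto_filtermap_eq[OF eq, where h = "\<lambda>T. \<langle>f, T (dual_lact ptensor_ract a x) - dual_lact (*) a (T x)\<rangle>"]
      tendsto_filtermap_eq[OF eq, where h = "\<lambda>T. \<langle>f, T (dual_ract ptensor_lact x a) - dual_ract (*) (T x) a\<rangle>"]
    by blast+
  ultimately have "wstar_approx_bimodule_morphism (dual_lact ptensor_ract) (dual_ract ptensor_lact) (*) (*) D' le' \<theta>'"
    using D'(1) unfolding wstar_approx_bimodule_morphism_def by blast
  moreover have "wstar_ot_tendsto (\<lambda>d. \<theta>' d \<circ> dual_map product_map) id (net_filter D' le')"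
    using lim tendsto_filtermap_eq[OF eq, where h = "\<lambda>T. norm \<langle>_, T (dual_map product_map _) - _\<rangle>"]
    unfolding wstar_ot_tendsto_def by simp
  ultimately show ?thesis
    unfolding has_wstar_approx_splitting_def by blast
qed

section \<open>From pseudo-amenability to splittings and their adjoints\<close>

text \<open>Letting \<open>x\<close> act on \<open>m d\<close> from the left makes
  \<open>\<beta> d\<close> an exact left module map; its error on the right is \<open>x\<close>
  acting on the commutator of \<open>a\<close> and \<open>m d\<close>.\<close>

lemma pseudo_amenable_imp_approx_splitting:
  assumes "pseudo_amenable TYPE('a::complex_banach_algebra)"
  shows "has_approx_splitting TYPE('a)"
proof -
  obtain D :: "('a, 'a) ptensor net_index set" and le and m :: "_ \<Rightarrow> ('a, 'a) ptensor"
    where D: "directed_index D le"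
      and com: "\<And>a. ((\<lambda>d. ptensor_lact a (m d) - ptensor_ract (m d) a) \<longlongrightarrow> 0) (net_filter D le)"
      and pi: "\<And>a. ((\<lambda>d. product_map (m d) * a) \<longlongrightarrow> a) (net_filter D le)"
    using assms unfolding pseudo_amenable_def by blast
  note bimod = banach_bimodule_ptensor[where 'a = 'a, unfolded banach_bimodule_def]
  define \<beta> where "\<beta> d x = ptensor_lact x (m d)" for d x
  have "approx_bimodule_morphism (*) (*) ptensor_lact ptensor_ract D le \<beta>"
    unfolding approx_bimodule_morphism_def
  proof (intro conjI D ballI allI)
    show "bounded_clinear (\<beta> d)" for d
      unfolding \<beta>_def by (rule bounded_cbilinear_clinear(2)) (use bimod in blast)
    show "((\<lambda>d. norm (\<beta> d (a * x) - ptensor_lact a (\<beta> d x))) \<longlongrightarrow> 0) (net_filter D le)" for a x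
      using bimod by (simp add: \<beta>_def)
    fix a x
    have "\<beta> d (x * a) - ptensor_ract (\<beta> d x) a
        = ptensor_lact x (ptensor_lact a (m d) - ptensor_ract (m d) a)" for d
      using bimod by (simp add: \<beta>_def linear_diff[OF bounded_linear.linear[OF bounded_linear_ptensor_acts(1)]])
    then show "((\<lambda>d. norm (\<beta> d (x * a) - ptensor_ract (\<beta> d x) a)) \<longlongrightarrow> 0) (net_filter D le)"
      using tendsto_norm_zero[OF bounded_linear.tendsto_zero[OF bounded_linear_ptensor_acts(1) com]] by simp
  qed
  moreover have "((\<lambda>d. norm (product_map (\<beta> d a) - a)) \<longlongrightarrow> 0) (net_filter D le)" for a
  proof -
    \<comment> \<open>Here \<open>\<beta> d\<close> produces \<open>a * product_map (m d)\<close>,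
      whereas \<open>pi\<close> concerns the product in the other order; the two differ by the image
      of a commutator.\<close>
    have "product_map (\<beta> d a) = product_map (ptensor_lact a (m d) - ptensor_ract (m d) a) + product_map (m d) * a" for d
      by (simp add: \<beta>_def linear_diff[OF bounded_linear.linear[OF bounded_linear_ptensor_acts(3)]] product_map_acts)
    then have "((\<lambda>d. product_map (\<beta> d a)) \<longlongrightarrow> a) (net_filter D le)"
      using tendsto_add[OF bounded_linear.tendsto_zero[OF bounded_linear_ptensor_acts(3) com] pi] by simp
    then show ?thesis
      by (intro tendsto_norm_zero LIM_zero)
  qed
  ultimately show ?thesis by (rule has_approx_splittingI)
qed

lemma bounded_clinear_dual_map:
  assumes T: "bounded_clinear T"
  shows "bounded_clinear (dual_map T)"
proof -
  interpret bounded_linear T using T by (simp add: bounded_clinear_def)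
  obtain K where K: "0 < K" "\<And>x. norm (T x) \<le> norm x * K" using pos_bounded by blast
  note p = pairing_dual_map[OF T]
  have scale: "dual_map T (c *\<^sub>C \<phi>) = c *\<^sub>C dual_map T \<phi>" for c \<phi>
    by (rule cdual_eqI) (simp add: p pairing_simps)
  have "norm (dual_map T \<phi>) \<le> norm \<phi> * K" for \<phi>
  proof (rule norm_cdual_bound)
    show "norm \<langle>x, dual_map T \<phi>\<rangle> \<le> norm \<phi> * K * norm x" for x
      using pairing_norm[of "T x" \<phi>] mult_left_mono[OF K(2)[of x] norm_ge_zero[of \<phi>]]
      by (simp add: p mult_ac)
  qed (use K(1) in simp)
  moreover have "dual_map T (\<phi> + \<psi>) = dual_map T \<phi> + dual_map T \<psi>" for \<phi> \<psi>
    by (rule cdual_eqI) (simp add: p pairing_simps)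
  ultimately have "bounded_linear (dual_map T)"
    by (intro bounded_linear_intro[where K = K]) (simp_all add: scale flip: scaleC_of_real)
  with scale show ?thesis by (simp add: bounded_clinear_def)
qed

lemma approx_splitting_imp_wstar_approx_splitting:
  assumes "has_approx_splitting TYPE('a::complex_banach_algebra)"
  shows "has_wstar_approx_splitting TYPE('a)"
proof -
  obtain D :: "('a \<Rightarrow> ('a, 'a) ptensor) net_index set" and le and \<beta> :: "_ \<Rightarrow> 'a \<Rightarrow> ('a, 'a) ptensor"
    where \<beta>: "approx_bimodule_morphism (*) (*) ptensor_lact ptensor_ract D le \<beta>"
      and pi: "\<And>a. ((\<lambda>d. norm (product_map (\<beta> d a) - a)) \<longlongrightarrow> 0) (net_filter D le)"
    using assms unfolding has_approx_splitting_def by blast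
  then have D: "directed_index D le" and cl: "\<And>d. d \<in> D \<Longrightarrow> bounded_clinear (\<beta> d)"
    and l: "\<And>a x. ((\<lambda>d. \<beta> d (a * x) - ptensor_lact a (\<beta> d x)) \<longlongrightarrow> 0) (net_filter D le)"
    and r: "\<And>a x. ((\<lambda>d. \<beta> d (x * a) - ptensor_ract (\<beta> d x) a) \<longlongrightarrow> 0) (net_filter D le)"
    unfolding approx_bimodule_morphism_def tendsto_norm_zero_iff by blast+
  have pair0: "((\<lambda>d. \<langle>f d, \<phi>\<rangle>) \<longlongrightarrow> 0) F" if "(f \<longlongrightarrow> 0) F"
    for f :: "_ \<Rightarrow> 'x::complex_normed_vector" and \<phi> F
    by (rule bounded_linear.tendsto_zero[OF pairing_bounded_linear(1) that])
  define \<theta> where "\<theta> d = dual_map (\<beta> d)" for d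
  \<comment> \<open>The adjoint is characterised only for bounded complex-linear maps, hence only
    for \<open>d \<in> D\<close>; the limits below are therefore compared eventually.\<close>
  have p: "\<langle>x, \<theta> d \<phi>\<rangle> = \<langle>\<beta> d x, \<phi>\<rangle>" if "d \<in> D" for d x \<phi>
    unfolding \<theta>_def by (rule pairing_dual_map[OF cl[OF that]])
  note mem = eventually_net_filter_mem[OF D]
  have "wstar_approx_bimodule_morphism (dual_lact ptensor_ract) (dual_ract ptensor_lact) (*) (*) D le \<theta>"
    unfolding wstar_approx_bimodule_morphism_def
  proof (intro conjI D ballI allI)
    show "bounded_clinear (\<theta> d)" if "d \<in> D" for d
      unfolding \<theta>_def by (rule bounded_clinear_dual_map[OF cl[OF that]])
    fix a \<phi> f
    \<comment> \<open>Dual actions exchange sides: the left error of \<open>\<theta> d\<close> is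
      minus the right error of \<open>\<beta> d\<close>, paired with \<open>\<phi>\<close>, and
      conversely below.\<close>
    have "((\<lambda>d. - \<langle>\<beta> d (f * a) - ptensor_ract (\<beta> d f) a, \<phi>\<rangle>) \<longlongrightarrow> 0) (net_filter D le)"
      using tendsto_minus[OF pair0[OF r]] by simp
    then show "((\<lambda>d. \<langle>f, \<theta> d (dual_lact ptensor_ract a \<phi>) - dual_lact (*) a (\<theta> d \<phi>)\<rangle>) \<longlongrightarrow> 0) (net_filter D le)"
      by (rule tendsto_cong[THEN iffD1, rotated], intro eventually_mono[OF mem])
        (simp add: p pairing_linear_simps pairing_ptensor_acts pairing_self_acts)
    have "((\<lambda>d. - \<langle>\<beta> d (a * f) - ptensor_lact a (\<beta> d f), \<phi>\<rangle>) \<longlongrightarrow> 0) (net_filter D le)"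
      using tendsto_minus[OF pair0[OF l]] by simp
    then show "((\<lambda>d. \<langle>f, \<theta> d (dual_ract ptensor_lact \<phi> a) - dual_ract (*) (\<theta> d \<phi>) a\<rangle>) \<longlongrightarrow> 0) (net_filter D le)"
      by (rule tendsto_cong[THEN iffD1, rotated], intro eventually_mono[OF mem])
        (simp add: p pairing_linear_simps pairing_ptensor_acts pairing_self_acts)
  qed
  moreover have "wstar_ot_tendsto (\<lambda>d. \<theta> d \<circ> dual_map product_map) id (net_filter D le)"
    unfolding wstar_ot_tendsto_def tendsto_norm_zero_iff
  proof (intro allI)
    fix \<psi> f
    have "((\<lambda>d. \<langle>product_map (\<beta> d f) - f, \<psi>\<rangle>) \<longlongrightarrow> 0) (net_filter D le)"
      using pi by (intro pair0) (simp add: tendsto_norm_zero_iff)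
    then show "((\<lambda>d. \<langle>f, (\<theta> d \<circ> dual_map product_map) \<psi> - id \<psi>\<rangle>) \<longlongrightarrow> 0) (net_filter D le)"
      by (rule tendsto_cong[THEN iffD1, rotated], intro eventually_mono[OF mem])
        (simp add: p pairing_linear_simps pairing_dual_map[OF bounded_clinear_product_map])
  qed
  ultimately show ?thesis by (rule has_wstar_approx_splittingI)
qed

section \<open>The implications back to pseudo-amenability\<close>

text \<open>Carries the identity assumed in the dual criterion through the maps
  \<open>\<theta> d\<close>.\<close>

lemma bounded_clinear_sum_zero:
  assumes "bounded_clinear T" and "(\<Sum>i\<in>I. u i - v i + w i) = 0"
  shows "(\<Sum>i\<in>I. T (u i) - T (v i) + T (w i)) = 0"
proof -
  have "linear T"
    using assms(1) by (simp add: bounded_clinear_def bounded_linear.linear)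
  then have "(\<Sum>i\<in>I. T (u i) - T (v i) + T (w i)) = T (\<Sum>i\<in>I. u i - v i + w i)"
    by (simp add: linear_sum linear_add linear_diff)
  with assms(2) \<open>linear T\<close> show ?thesis by (simp add: linear_0)
qed

lemma wstar_approx_splitting_imp_pseudo_amenable:
  assumes "has_central_approx_identity TYPE('a::complex_banach_algebra)"
    and "has_wstar_approx_splitting TYPE('a)"
  shows "pseudo_amenable TYPE('a)"
proof (rule pseudo_amenableI_dual)
  fix n and a :: "nat \<Rightarrow> 'a" and \<phi> :: "nat \<Rightarrow> ('a, 'a) ptensor cdual" and \<psi> :: "nat \<Rightarrow> 'a cdual"
  assume zero: "(\<Sum>i<n. dual_ract ptensor_lact (\<phi> i) (a i) - dual_lact ptensor_ract (a i) (\<phi> i)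
      + dual_map product_map (dual_lact (*) (a i) (\<psi> i))) = 0"
  obtain I :: "'a net_index set" and leI and e :: "_ \<Rightarrow> 'a" where I: "directed_index I leI"
    and e: "\<And>a. ((\<lambda>i. e i * a) \<longlongrightarrow> a) (net_filter I leI)"
    and central: "\<And>i a. i \<in> I \<Longrightarrow> e i * a = a * e i"
    using assms(1) unfolding has_central_approx_identity_def approx_identity_def by blast
  obtain D :: "(('a, 'a) ptensor cdual \<Rightarrow> 'a cdual) net_index set" and le
    and \<theta> :: "_ \<Rightarrow> ('a, 'a) ptensor cdual \<Rightarrow> 'a cdual"
    where D: "directed_index D le" and cl: "\<And>d. d \<in> D \<Longrightarrow> bounded_clinear (\<theta> d)"
    and l: "\<And>a x f. ((\<lambda>d. \<langle>f, \<theta> d (dual_lact ptensor_ract a x) - dual_lact (*) a (\<theta> d x)\<rangle>) \<longlongrightarrow> 0) (net_filter D le)"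
    and r: "\<And>a x f. ((\<lambda>d. \<langle>f, \<theta> d (dual_ract ptensor_lact x a) - dual_ract (*) (\<theta> d x) a\<rangle>) \<longlongrightarrow> 0) (net_filter D le)"
    and w: "\<And>x f. ((\<lambda>d. \<langle>f, \<theta> d (dual_map product_map x) - x\<rangle>) \<longlongrightarrow> 0) (net_filter D le)"
    using assms(2)
    unfolding has_wstar_approx_splitting_def wstar_approx_bimodule_morphism_def wstar_ot_tendsto_def
      tendsto_norm_zero_iff
    by auto
  have "(\<Sum>i<n. \<langle>z * a i, \<psi> i\<rangle>) = 0" if z: "\<And>x. z * x = x * z" for z
  proof -
    \<comment> \<open>The three error terms vanish along \<open>D\<close>, leaving the wanted sum as
      limit. For each \<open>d \<in> D\<close> the expression is exactly zero: the subtracted terms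
      cancel because \<open>a i * z = z * a i\<close>, and the rest is the image of
      \<open>zero\<close> under \<open>\<theta> d\<close>.\<close>
    let ?s = "\<lambda>d. \<Sum>i<n. \<langle>z, \<theta> d (dual_ract ptensor_lact (\<phi> i) (a i)) - dual_ract (*) (\<theta> d (\<phi> i)) (a i)\<rangle>
      - \<langle>z, \<theta> d (dual_lact ptensor_ract (a i) (\<phi> i)) - dual_lact (*) (a i) (\<theta> d (\<phi> i))\<rangle>
      + (\<langle>z, \<theta> d (dual_map product_map (dual_lact (*) (a i) (\<psi> i))) - dual_lact (*) (a i) (\<psi> i)\<rangle>
        + \<langle>z * a i, \<psi> i\<rangle>)"
    have "?s d = 0" if "d \<in> D" for d
    proof -
      have "?s d = \<langle>z, \<Sum>i<n. \<theta> d (dual_ract ptensor_lact (\<phi> i) (a i)) - \<theta> d (dual_lact ptensor_ract (a i) (\<phi> i))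
          + \<theta> d (dual_map product_map (dual_lact (*) (a i) (\<psi> i)))\<rangle>"
        by (simp add: pairing_linear_simps pairing_self_acts z)
      then show ?thesis
        by (simp add: bounded_clinear_sum_zero[OF cl[OF that] zero] pairing_linear_simps)
    qed
    then have "(?s \<longlongrightarrow> 0) (net_filter D le)"
      by (intro tendsto_eventually eventually_mono[OF eventually_net_filter_mem[OF D]])
    moreover have "(?s \<longlongrightarrow> (\<Sum>i<n. 0 - 0 + (0 + \<langle>z * a i, \<psi> i\<rangle>))) (net_filter D le)"
      by (intro tendsto_sum tendsto_add tendsto_diff l r w tendsto_const)
    ultimately show ?thesis
      using tendsto_unique[OF net_filter_neq_bot[OF D]] by fastforce
  qed
  \<comment> \<open>Only now does the central element run through the approximate identity; its
    centrality is given on \<open>I\<close>, hence eventually.\<close>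
  then have "((\<lambda>j. \<Sum>i<n. \<langle>e j * a i, \<psi> i\<rangle>) \<longlongrightarrow> 0) (net_filter I leI)"
    using central by (intro tendsto_eventually eventually_mono[OF eventually_net_filter_mem[OF I]]) blast
  moreover have "((\<lambda>j. \<Sum>i<n. \<langle>e j * a i, \<psi> i\<rangle>) \<longlongrightarrow> (\<Sum>i<n. \<langle>a i, \<psi> i\<rangle>)) (net_filter I leI)"
    by (intro tendsto_sum bounded_linear.tendsto[OF pairing_bounded_linear(1)] e)
  ultimately show "(\<Sum>i<n. \<langle>a i, \<psi> i\<rangle>) = 0"
    using tendsto_unique[OF net_filter_neq_bot[OF I]] by blast
qed

lemma approx_biflat_imp_pseudo_amenable:
  assumes "has_approx_identity TYPE('a::complex_banach_algebra)" and "approx_biflat TYPE('a)"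
  shows "pseudo_amenable TYPE('a)"
proof (rule pseudo_amenableI_dual)
  fix n and a :: "nat \<Rightarrow> 'a" and \<phi> :: "nat \<Rightarrow> ('a, 'a) ptensor cdual" and \<psi> :: "nat \<Rightarrow> 'a cdual"
  assume zero: "(\<Sum>i<n. dual_ract ptensor_lact (\<phi> i) (a i) - dual_lact ptensor_ract (a i) (\<phi> i)
      + dual_map product_map (dual_lact (*) (a i) (\<psi> i))) = 0"
  obtain I :: "'a net_index set" and leI and e :: "_ \<Rightarrow> 'a" where I: "directed_index I leI"
    and e: "\<And>a. ((\<lambda>i. e i * a) \<longlongrightarrow> a) (net_filter I leI)" "\<And>a. ((\<lambda>i. a * e i) \<longlongrightarrow> a) (net_filter I leI)"
    using assms(1) unfolding has_approx_identity_def approx_identity_def by blast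
  obtain D :: "(('a, 'a) ptensor cdual \<Rightarrow> 'a cdual) net_index set" and le
    and \<theta> :: "_ \<Rightarrow> ('a, 'a) ptensor cdual \<Rightarrow> 'a cdual"
    where D: "directed_index D le"
    and \<theta>: "\<And>d. d \<in> D \<Longrightarrow> bimodule_morphism (dual_lact ptensor_ract) (dual_ract ptensor_lact)
      (dual_lact (*)) (dual_ract (*)) (\<theta> d)"
    and w: "\<And>x f. ((\<lambda>d. \<langle>f, \<theta> d (dual_map product_map x) - x\<rangle>) \<longlongrightarrow> 0) (net_filter D le)"
    using assms(2) unfolding approx_biflat_def wstar_ot_tendsto_def tendsto_norm_zero_iff by auto
  \<comment> \<open>The adjoint of \<open>product_map\<close> respects the left action, so
    \<open>a i\<close> can be pulled out through \<open>\<theta> d\<close> and moved onto the test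
    element \<open>z\<close>.\<close>
  have dual_pi: "dual_map product_map (dual_lact (*) b x) = dual_lact ptensor_ract b (dual_map product_map x)"
    for b :: 'a and x
    by (rule cdual_eqI)
      (simp add: pairing_dual_map[OF bounded_clinear_product_map] pairing_self_acts pairing_ptensor_acts
        product_map_acts)
  have "(\<Sum>i<n. \<langle>a i, \<theta> d (dual_map product_map (\<psi> i))\<rangle>) = 0" if d: "d \<in> D" for d
  proof -
    have cl: "bounded_clinear (\<theta> d)"
      and l: "\<And>b x. \<theta> d (dual_lact ptensor_ract b x) = dual_lact (*) b (\<theta> d x)"
      and r: "\<And>b x. \<theta> d (dual_ract ptensor_lact x b) = dual_ract (*) (\<theta> d x) b"
      using \<theta>[OF d] by (auto simp: bimodule_morphism_def)
    let ?s = "\<lambda>z. \<Sum>i<n. \<langle>a i * z, \<theta> d (\<phi> i)\<rangle> - \<langle>z * a i, \<theta> d (\<phi> i)\<rangle>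
      + \<langle>z * a i, \<theta> d (dual_map product_map (\<psi> i))\<rangle>"
    have "?s z = 0" for z
    proof -
      have "?s z = \<langle>z, \<Sum>i<n. \<theta> d (dual_ract ptensor_lact (\<phi> i) (a i)) - \<theta> d (dual_lact ptensor_ract (a i) (\<phi> i))
          + \<theta> d (dual_map product_map (dual_lact (*) (a i) (\<psi> i)))\<rangle>"
        by (simp add: pairing_linear_simps pairing_self_acts l r dual_pi)
      then show ?thesis
        by (simp add: bounded_clinear_sum_zero[OF cl zero] pairing_linear_simps)
    qed
    \<comment> \<open>With \<open>d\<close> fixed, \<open>\<theta> d (\<phi> i)\<close> is a single
      functional, so the two-sided approximate identity makes the commutator terms cancel in the
      limit. The limit along \<open>D\<close> follows afterwards.\<close>
    moreover have "((\<lambda>j. ?s (e j)) \<longlongrightarrow> (\<Sum>i<n. \<langle>a i, \<theta> d (\<phi> i)\<rangle> - \<langle>a i, \<theta> d (\<phi> i)\<rangle>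
        + \<langle>a i, \<theta> d (dual_map product_map (\<psi> i))\<rangle>)) (net_filter I leI)"
      by (intro tendsto_sum tendsto_add tendsto_diff bounded_linear.tendsto[OF pairing_bounded_linear(1)] e)
    ultimately show ?thesis
      using tendsto_unique[OF net_filter_neq_bot[OF I] tendsto_const[of 0]] by fastforce
  qed
  then have "((\<lambda>d. \<Sum>i<n. \<langle>a i, \<theta> d (dual_map product_map (\<psi> i))\<rangle>) \<longlongrightarrow> 0) (net_filter D le)"
    by (intro tendsto_eventually eventually_mono[OF eventually_net_filter_mem[OF D]])
  moreover have "((\<lambda>d. \<Sum>i<n. \<langle>a i, \<theta> d (dual_map product_map (\<psi> i))\<rangle>) \<longlongrightarrow> (\<Sum>i<n. \<langle>a i, \<psi> i\<rangle>)) (net_filter D le)"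
    using w by (intro tendsto_sum) (simp add: pairing_linear_simps LIM_zero_iff)
  ultimately show "(\<Sum>i<n. \<langle>a i, \<psi> i\<rangle>) = 0"
    using tendsto_unique[OF net_filter_neq_bot[OF D]] by blast
qed

theorem theorem2p4:
  shows "(pseudo_amenable TYPE('a::complex_banach_algebra) \<longrightarrow> has_approx_splitting TYPE('a))
    \<and> (has_approx_splitting TYPE('a) \<longrightarrow> has_wstar_approx_splitting TYPE('a))
    \<and> (has_central_approx_identity TYPE('a) \<longrightarrow>
        has_wstar_approx_splitting TYPE('a) \<longrightarrow> pseudo_amenable TYPE('a))
    \<and> (has_approx_identity TYPE('a) \<longrightarrow> approx_biflat TYPE('a) \<longrightarrow> pseudo_amenable TYPE('a))"
  using pseudo_amenable_imp_approx_splitting approx_splitting_imp_wstar_approx_splitting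
    wstar_approx_splitting_imp_pseudo_amenable approx_biflat_imp_pseudo_amenable by blast

end
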